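(* Let $d_1,d_2\in\{1,2,\ldots\}$, $d=d_1+d_2$, let $V\colon\mathbb{R}^d\to\mathbb{R}$ be Borel measurable, and let $p_1,p_2\in[1,\infty]$ satisfy $\frac{d_1}{2p_1}+\frac{d_2}{2p_2}=1$. Let $G$ be the Schrödinger perturbation of the Gauss-Weierstrass kernel $g$ on $\mathbb{R}^d$ by $V$. (a) If $r\in(p_1,\infty]$ and $V(x_1,x_2)=V_1(x_1)V_2(x_2)$ for $x_1\in\mathbb{R}^{d_1}$, $x_2\in\mathbb{R}^{d_2}$, where $V_1\in L^{r}(\mathbb{R}^{d_1})$ and $V_2\in L^{p_2}(\mathbb{R}^{d_2})$, then for every $T\in(0,\infty)$ there are numbers $0<c_1\le c_2<\infty$ such that $$c_1\le\frac{G(t,x,y)}{g(t,x,y)}\le c_2,\qquad 0<t\le T,\ x,y\in\mathbb{R}^d .$$ (b) If $V\le 0$, $1\le q<p_1<r\le\infty$ and $V(x_1,x_2)=V_1(x_1)V_2(x_2)$ for $x_1\in\mathbb{R}^{d_1}$, $x_2\in\mathbb{R}^{d_2}$, where $V_1\in L^{q}(\mathbb{R}^{d_1})\cap L^{r}(\mathbb{R}^{d_1})$ and $V_2\in L^{p_2}(\mathbb{R}^{d_2})$, then there are numbers $0<c_1\le c_2<\infty$ such that $$c_1\le\frac{G(t,x,y)}{g(t,x,y)}\le c_2,\qquad t>0,\ x,y\in\mathbb{R}^d .$$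
   Context: The Gauss-Weierstrass kernel on $\mathbb{R}^d$ is $g(t,x,y)=(4\pi t)^{-d/2}e^{-|y-x|^2/(4t)}$, $t>0$, $x,y\in\mathbb{R}^d$. The Schrödinger perturbation $G$ of $g$ by $V$ (the fundamental solution of $\partial_t=\Delta+V$) is given by the perturbation series $G(t,x,y)=\sum_{n=0}^\infty g_n(t,x,y)$, where $g_0=g$ and $$g_n(t,x,y)=\int_0^t\int_{\mathbb{R}^d}g_{n-1}(s,x,z)V(z)g(t-s,z,y)\,dz\,ds,\qquad n\ge 1 .$$ Under the hypotheses of the statement the integrals and the series converge absolutely, and $G$ satisfies the Duhamel formula $G(t,x,y)=g(t,x,y)+\int_0^t\int_{\mathbb{R}^d}G(s,x,z)V(z)g(t-s,z,y)\,dz\,ds$. The convention $1/\infty=0$ is used. *)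

theory Defs
  imports "HOL-Analysis.Analysis"
begin

text \<open>
  The Lebesgue space $L^p(M)$ of real-valued functions, for $p \in [1,\infty]$.  Its members are
  functions, not equivalence classes modulo null sets.
\<close>

definition Lp_space :: "ennreal \<Rightarrow> 'a measure \<Rightarrow> ('a \<Rightarrow> real) set" where
  "Lp_space p M = {f \<in> borel_measurable M.
     if p = \<infinity> then \<exists>C. AE x in M. \<bar>f x\<bar> \<le> C
     else (\<integral>\<^sup>+ x. ennreal (\<bar>f x\<bar> powr enn2real p) \<partial>M) < \<infinity>}"

text \<open>Only used for \<open>t > 0\<close>.\<close>

definition gauss_kernel :: "real \<Rightarrow> 'a::euclidean_space \<Rightarrow> 'a \<Rightarrow> real" where
  "gauss_kernel t x y =
     (4 * pi * t) powr (- (real DIM('a) / 2)) * exp (- (norm (y - x))\<^sup>2 / (4 * t))"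

text \<open>
  The iterated integrals are Bochner integrals and the series is an ordinary \<open>suminf\<close>: the
  definitions are meaningful for potentials for which these converge.
\<close>

primrec perturbation_term ::
  "('a::euclidean_space \<Rightarrow> real) \<Rightarrow> nat \<Rightarrow> real \<Rightarrow> 'a \<Rightarrow> 'a \<Rightarrow> real" where
  "perturbation_term V 0 = gauss_kernel"
| "perturbation_term V (Suc n) = (\<lambda>t x y.
     LINT s:{0<..<t}|lborel. LINT z|lborel.
       perturbation_term V n s x z * V z * gauss_kernel (t - s) z y)"

definition schroedinger_kernel ::
  "('a::euclidean_space \<Rightarrow> real) \<Rightarrow> real \<Rightarrow> 'a \<Rightarrow> 'a \<Rightarrow> real" where
  "schroedinger_kernel V t x y = (\<Sum>n. perturbation_term V n t x y)"

end

(*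
A Brownian bridge from x to y of duration t has at time s a Gaussian law of variance parameter
s (t - s) / t.  Hence the ratio of the first-order term to g is the time integral of Gaussian
averages of |V|, which for a product potential factorise and are bounded by C tau^(-a) with a < 1;
so the ratio is small for small t, and for V in two such classes (a < 1 < b) it is bounded
uniformly in t.  Small times give absolute convergence with the bounds g exp(-4 u / g) <= G
(u being the first-order term of |V|) and, if V <= 0, G <= g.  The Chapman-Kolmogorov equation then
doubles the time: the upper bound is reproduced trivially, and the lower bound by Jensen's
inequality for the bridge measure, because u / g is additive along the bridge.
*)
theory Submission
  imports Defs "HOL-Probability.Distributions"
begin

section \<open>The Gaussian kernel\<close>

text \<open>The lower bound has the form g exp(-4 u / g), rather than g times a constant, because it
  must survive unboundedly many doublings: a constant c < 1 would turn into c^2, c^4 and so on,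
  whereas the ratio u / g adds up, so the factor 4 never deteriorates and everything is left to a
  bound on u / g. The 4 comes from the smallness threshold: if u \<le> g / 4, the term of order n +
  1 is at most (1/4)^n u in absolute value, hence G \<ge> g - (4/3) u, and 1 - (4/3) h \<ge> exp(-4
  h) for 0 \<le> h \<le> 1/4. In the upper bound of (a) the constant is squared, which is harmless
  because finitely many doublings reach T; in (b) it is 1. The obstacle is that V has no sign in (a)
  and that the terms are Bochner integrals, which default to 0 without integrability: every
  interchange of integrals needs a majorant, and the majorants come from the first-order term of
  |V|. The Chapman-Kolmogorov equation is established for the single terms, since convergence of the
  series at large times is itself obtained by doubling.\<close>

lemma gauss_kernel_pos: "0 < t \<Longrightarrow> 0 < gauss_kernel t x y"
  by (simp add: gauss_kernel_def)

lemma gauss_kernel_nonneg [simp]: "0 \<le> gauss_kernel t x y"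
  by (simp add: gauss_kernel_def)

lemma borel_measurable_gauss_kernel [measurable (raw)]:
  fixes x y :: "'m \<Rightarrow> 'c::euclidean_space"
  assumes [measurable]: "t \<in> borel_measurable M" "x \<in> borel_measurable M" "y \<in> borel_measurable M"
  shows "(\<lambda>w. gauss_kernel (t w) (x w) (y w)) \<in> borel_measurable M"
  unfolding gauss_kernel_def by measurable

lemma gauss_kernel_le:
  fixes x y :: "'c::euclidean_space"
  assumes "0 < t"
  shows "gauss_kernel t x y \<le> (4 * pi * t) powr (- (real DIM('c) / 2))"
  using assms by (simp add: gauss_kernel_def mult_le_cancel_left1)

lemma gauss_kernel_Pair:
  fixes x1 y1 :: "'a::euclidean_space" and x2 y2 :: "'b::euclidean_space"
  shows "gauss_kernel t (x1, x2) (y1, y2) = gauss_kernel t x1 y1 * gauss_kernel t x2 y2"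
proof -
  have "(norm ((y1, y2) - (x1, x2)))\<^sup>2 = (norm (y1 - x1))\<^sup>2 + (norm (y2 - x2))\<^sup>2"
    by (simp add: norm_Pair)
  then have "exp (- (norm ((y1, y2) - (x1, x2)))\<^sup>2 / (4 * t))
      = exp (- (norm (y1 - x1))\<^sup>2 / (4 * t)) * exp (- (norm (y2 - x2))\<^sup>2 / (4 * t))"
    by (simp only: exp_add [symmetric] minus_add_distrib add_divide_distrib)
  moreover have "(4 * pi * t) powr (- (real DIM('a \<times> 'b) / 2))
      = (4 * pi * t) powr (- (real DIM('a) / 2)) * (4 * pi * t) powr (- (real DIM('b) / 2))"
    by (simp add: powr_add [symmetric] add_divide_distrib)
  ultimately show ?thesis by (simp only: gauss_kernel_def mult_ac)
qed

text \<open>The kernel at time t is a Gaussian density with variance 2 t in every coordinate, so its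
  total mass reduces to that of one-dimensional normal densities.\<close>

lemma gauss_kernel_eq_prod:
  fixes x y :: "'c::euclidean_space"
  assumes "0 < t"
  shows "gauss_kernel t x y = (\<Prod>b\<in>Basis. normal_density (x \<bullet> b) (sqrt (2 * t)) (y \<bullet> b))"
proof -
  have "(norm (y - x))\<^sup>2 = (\<Sum>b\<in>Basis. (y \<bullet> b - x \<bullet> b)\<^sup>2)"
    unfolding power2_norm_eq_inner by (subst euclidean_inner) (simp add: power2_eq_square inner_diff_left)
  then have "exp (- (norm (y - x))\<^sup>2 / (4 * t)) = (\<Prod>b\<in>Basis. exp (- (y \<bullet> b - x \<bullet> b)\<^sup>2 / (4 * t)))"
    by (simp add: exp_sum [symmetric] sum_negf sum_divide_distrib)
  moreover have "(4 * pi * t) powr (- (real DIM('c) / 2)) = (\<Prod>b\<in>(Basis::'c set). 1 / sqrt (4 * pi * t))"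
  proof -
    have "(4 * pi * t) powr (- (real DIM('c) / 2)) = ((4 * pi * t) powr (- (1 / 2))) powr real DIM('c)"
      by (simp add: powr_powr)
    also have "\<dots> = ((4 * pi * t) powr (- (1 / 2))) ^ DIM('c)"
      using assms by (simp add: powr_realpow)
    also have "(4 * pi * t) powr (- (1 / 2)) = 1 / sqrt (4 * pi * t)"
      using assms by (simp add: powr_minus powr_half_sqrt field_simps)
    finally show ?thesis by simp
  qed
  moreover have "normal_density (x \<bullet> b) (sqrt (2 * t)) (y \<bullet> b)
      = 1 / sqrt (4 * pi * t) * exp (- (y \<bullet> b - x \<bullet> b)\<^sup>2 / (4 * t))" for b
    using assms by (simp add: normal_density_def mult_ac)
  ultimately show ?thesis
    by (simp only: gauss_kernel_def prod.distrib)
qed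

lemma nn_integral_gauss_kernel:
  fixes x :: "'c::euclidean_space"
  assumes "0 < t"
  shows "(\<integral>\<^sup>+y. ennreal (gauss_kernel t x y) \<partial>lborel) = 1"
proof -
  have "(\<integral>\<^sup>+y. ennreal (gauss_kernel t x y) \<partial>lborel)
     = (\<integral>\<^sup>+y. (\<Prod>b\<in>Basis. ennreal (normal_density (x \<bullet> b) (sqrt (2 * t)) (y \<bullet> b))) \<partial>lborel)"
    using assms by (simp add: gauss_kernel_eq_prod prod_ennreal)
  also have "\<dots> = (\<Prod>b\<in>(Basis::'c set). \<integral>\<^sup>+z. ennreal (normal_density (x \<bullet> b) (sqrt (2 * t)) z) \<partial>lborel)"
    by (subst nn_integral_lborel_prod) auto
  also have "\<dots> = 1"
    using assms by (simp add: nn_integral_eq_integral)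
  finally show ?thesis .
qed

text \<open>Completing the square in z. The last factor is the bridge density at time s: its centre
  lies at the fraction s / t of the segment from x to y, and s (t - s) / t is half its variance per
  coordinate. The semigroup law is the integral of this identity over z; the estimates of the
  first-order term use it with |V| inserted.\<close>

lemma gauss_kernel_bridge:
  fixes x y z :: "'c::euclidean_space"
  assumes "0 < s" "s < t"
  shows "gauss_kernel s x z * gauss_kernel (t - s) z y
    = gauss_kernel t x y * gauss_kernel (s * (t - s) / t) (x + (s / t) *\<^sub>R (y - x)) z"
proof -
  define r where "r = t - s"
  have t: "t = s + r" and r: "0 < r" using assms by (auto simp: r_def)
  define u where "u = z - x"
  define w where "w = y - x"
  have e1: "z - (x + (s / t) *\<^sub>R (y - x)) = u - (s / t) *\<^sub>R w" "y - z = w - u"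
    by (auto simp: u_def w_def)
  have n: "(norm (u - k *\<^sub>R w))\<^sup>2 = u \<bullet> u - 2 * k * (u \<bullet> w) + k\<^sup>2 * (w \<bullet> w)" for k
    unfolding power2_norm_eq_inner
    by (simp add: inner_diff_left inner_diff_right inner_commute power2_eq_square algebra_simps)
  have n1: "(norm (w - u))\<^sup>2 = u \<bullet> u - 2 * (u \<bullet> w) + w \<bullet> w"
    using n[of 1] by (simp add: norm_minus_commute)
  have "- (u \<bullet> u) / (4 * s) + - (u \<bullet> u - 2 * (u \<bullet> w) + w \<bullet> w) / (4 * r)
     = - (w \<bullet> w) / (4 * t) + - (u \<bullet> u - 2 * (s / t) * (u \<bullet> w) + (s / t)\<^sup>2 * (w \<bullet> w)) / (4 * (s * r / t))"
    using assms r unfolding t power2_eq_square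
    by (simp add: divide_simps) algebra
  then have e: "- (norm (z - x))\<^sup>2 / (4 * s) + - (norm (y - z))\<^sup>2 / (4 * r)
     = - (norm (y - x))\<^sup>2 / (4 * t) + - (norm (z - (x + (s / t) *\<^sub>R (y - x))))\<^sup>2 / (4 * (s * r / t))"
    unfolding e1 n n1 by (simp add: power2_norm_eq_inner u_def w_def)
  have "(4 * pi * s) * (4 * pi * r) = (4 * pi * t) * (4 * pi * (s * r / t))"
    using assms by (simp add: field_simps)
  then have p: "(4 * pi * s) powr k * (4 * pi * r) powr k = (4 * pi * t) powr k * (4 * pi * (s * r / t)) powr k" for k
    by (metis powr_mult)
  have "gauss_kernel s x z * gauss_kernel r z y
    = ((4 * pi * s) powr (- (real DIM('c) / 2)) * (4 * pi * r) powr (- (real DIM('c) / 2))) *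
      exp (- (norm (z - x))\<^sup>2 / (4 * s) + - (norm (y - z))\<^sup>2 / (4 * r))"
    by (simp only: gauss_kernel_def exp_add mult_ac)
  also have "\<dots> = gauss_kernel t x y * gauss_kernel (s * r / t) (x + (s / t) *\<^sub>R (y - x)) z"
    unfolding e p by (simp only: gauss_kernel_def exp_add mult_ac)
  finally show ?thesis by (simp add: r_def)
qed

lemma nn_integral_gauss_kernel_semigroup:
  fixes x y :: "'c::euclidean_space"
  assumes "0 < s" "0 < t"
  shows "(\<integral>\<^sup>+z. ennreal (gauss_kernel s x z * gauss_kernel t z y) \<partial>lborel) = ennreal (gauss_kernel (s + t) x y)"
proof -
  have "0 < s * t / (s + t)" using assms by simp
  then show ?thesis
    using gauss_kernel_bridge[of s "s + t" x _ y] assms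
    by (simp add: ennreal_mult nn_integral_cmult nn_integral_gauss_kernel)
qed

lemma nn_integral_cmult_gauss_kernel_semigroup:
  fixes x y :: "'c::euclidean_space"
  assumes "0 < s" "0 < t" "0 \<le> c"
  shows "(\<integral>\<^sup>+z. ennreal (c * (gauss_kernel s x z * gauss_kernel t z y)) \<partial>lborel) = ennreal (c * gauss_kernel (s + t) x y)"
proof -
  have "(\<integral>\<^sup>+z. ennreal (c * (gauss_kernel s x z * gauss_kernel t z y)) \<partial>lborel)
    = (\<integral>\<^sup>+z. ennreal c * ennreal (gauss_kernel s x z * gauss_kernel t z y) \<partial>lborel)"
    using \<open>0 \<le> c\<close> by (simp only: ennreal_mult')
  also have "\<dots> = ennreal c * (\<integral>\<^sup>+z. ennreal (gauss_kernel s x z * gauss_kernel t z y) \<partial>lborel)"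
    by (rule nn_integral_cmult) measurable
  also have "\<dots> = ennreal (c * gauss_kernel (s + t) x y)"
    using assms by (simp only: nn_integral_gauss_kernel_semigroup ennreal_mult')
  finally show ?thesis .
qed

lemma
  fixes x y :: "'c::euclidean_space"
  assumes "0 < s" "0 < t"
  shows integrable_gauss_kernel_semigroup: "integrable lborel (\<lambda>z. gauss_kernel s x z * gauss_kernel t z y)"
    and integral_gauss_kernel_semigroup:
      "(\<integral>z. gauss_kernel s x z * gauss_kernel t z y \<partial>lborel) = gauss_kernel (s + t) x y"
  using nn_integral_gauss_kernel_semigroup[OF assms, of x y]
  by (auto intro!: integrableI_nonneg integral_eq_nn_integral[THEN trans] simp: enn2real_ennreal)

section \<open>The perturbation series\<close>

text \<open>The first-order term of |V|, as an extended nonnegative integral: it can be estimated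
  before anything is known to be integrable. The majorants for the Bochner integrals below are built
  from its integrand.\<close>

definition kato_integral :: "('c::euclidean_space \<Rightarrow> real) \<Rightarrow> real \<Rightarrow> 'c \<Rightarrow> 'c \<Rightarrow> ennreal" where
  "kato_integral V t x y = (\<integral>\<^sup>+s. indicator {0<..<t} s *
     (\<integral>\<^sup>+z. ennreal (gauss_kernel s x z * \<bar>V z\<bar> * gauss_kernel (t - s) z y) \<partial>lborel) \<partial>lborel)"

section \<open>Joint measurability of the terms in time and space\<close>

lemma borel_measurable_fst_snd [measurable (raw)]:
  fixes f :: "'m \<Rightarrow> 'a::second_countable_topology \<times> 'b::second_countable_topology"
  assumes "f \<in> borel_measurable M"
  shows "(\<lambda>x. fst (f x)) \<in> borel_measurable M" "(\<lambda>x. snd (f x)) \<in> borel_measurable M"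
  using assms measurable_comp[of f M borel fst borel] measurable_comp[of f M borel snd borel]
  unfolding comp_def borel_prod [symmetric] by auto

text \<open>Written as a conditional on two inequalities, the indicator of an interval with variable
  end point t is jointly measurable in s and t by the automatic rules.\<close>

lemma indicator_greaterThanLessThan_eq:
  "indicator {0<..<t} s = (if 0 < s \<and> s < t then 1 else 0)"
  by (simp add: indicator_def)

lemma borel_measurable_compose3:
  fixes F :: "real \<Rightarrow> 'c::euclidean_space \<Rightarrow> 'c \<Rightarrow> real"
  assumes "(\<lambda>p. F (fst p) (fst (snd p)) (snd (snd p))) \<in> borel_measurable borel"
    and [measurable]: "t \<in> borel_measurable M" "x \<in> borel_measurable M" "y \<in> borel_measurable M"
  shows "(\<lambda>w. F (t w) (x w) (y w)) \<in> borel_measurable M"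
  using measurable_compose[of "\<lambda>w. (t w, x w, y w)" M borel, OF _ assms(1)] by simp

lemma borel_measurable_perturbation_term_aux:
  fixes V :: "'c::euclidean_space \<Rightarrow> real"
  assumes [measurable]: "V \<in> borel_measurable borel"
  shows "(\<lambda>p. perturbation_term V n (fst p) (fst (snd p)) (snd (snd p))) \<in> borel_measurable borel"
proof (induction n)
  case 0
  then show ?case unfolding borel_prod [symmetric] by simp
next
  case (Suc n)
  note borel_measurable_compose3[OF Suc, measurable (raw)]
  show ?case
    unfolding borel_prod [symmetric]
    by (simp add: set_lebesgue_integral_def indicator_greaterThanLessThan_eq)
qed

lemmas borel_measurable_perturbation_term [measurable (raw)] =
  borel_measurable_compose3[OF borel_measurable_perturbation_term_aux]

text \<open>A function that is not integrable has Bochner integral 0, so terms can be estimated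
  before their integrals are known to converge.\<close>

lemma ennreal_abs_integral_le:
  fixes f :: "'m \<Rightarrow> real"
  shows "ennreal \<bar>integral\<^sup>L M f\<bar> \<le> (\<integral>\<^sup>+x. ennreal \<bar>f x\<bar> \<partial>M)"
  using integral_norm_bound_ennreal[of M f] by (cases "integrable M f") (auto simp: not_integrable_integral_eq)

text \<open>A bound C g on the previous term at earlier times passes to C times the first-order term
  of |V|. Keeping that term, instead of estimating it by g at once, serves the finer comparison with
  u later.\<close>

lemma perturbation_term_Suc_kato_bound:
  fixes V :: "'c::euclidean_space \<Rightarrow> real"
  assumes V [measurable]: "V \<in> borel_measurable borel" and "0 \<le> C"
    and bd: "\<And>s z. 0 < s \<Longrightarrow> s < t \<Longrightarrow> \<bar>perturbation_term V n s x z\<bar> \<le> C * gauss_kernel s x z"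
  shows "ennreal \<bar>perturbation_term V (Suc n) t x y\<bar> \<le> ennreal C * kato_integral V t x y"
proof -
  have "ennreal \<bar>perturbation_term V (Suc n) t x y\<bar> \<le> (\<integral>\<^sup>+s. ennreal \<bar>indicator {0<..<t} s *\<^sub>R
      (LINT z|lborel. perturbation_term V n s x z * V z * gauss_kernel (t - s) z y)\<bar> \<partial>lborel)"
    unfolding perturbation_term.simps set_lebesgue_integral_def by (rule ennreal_abs_integral_le)
  also have "\<dots> \<le> (\<integral>\<^sup>+s. ennreal C * (indicator {0<..<t} s *
     (\<integral>\<^sup>+z. ennreal (gauss_kernel s x z * \<bar>V z\<bar> * gauss_kernel (t - s) z y) \<partial>lborel)) \<partial>lborel)"
  proof (intro nn_integral_mono)
    fix s
    show "ennreal \<bar>indicator {0<..<t} s *\<^sub>R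
      (LINT z|lborel. perturbation_term V n s x z * V z * gauss_kernel (t - s) z y)\<bar>
      \<le> ennreal C * (indicator {0<..<t} s *
     (\<integral>\<^sup>+z. ennreal (gauss_kernel s x z * \<bar>V z\<bar> * gauss_kernel (t - s) z y) \<partial>lborel))"
    proof (cases "0 < s \<and> s < t")
      case True
      have "ennreal \<bar>LINT z|lborel. perturbation_term V n s x z * V z * gauss_kernel (t - s) z y\<bar>
        \<le> (\<integral>\<^sup>+z. ennreal \<bar>perturbation_term V n s x z * V z * gauss_kernel (t - s) z y\<bar> \<partial>lborel)"
        by (rule ennreal_abs_integral_le)
      also have "\<dots> \<le> (\<integral>\<^sup>+z. ennreal C * ennreal (gauss_kernel s x z * \<bar>V z\<bar> * gauss_kernel (t - s) z y) \<partial>lborel)"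
      proof (intro nn_integral_mono)
        fix z
        have "\<bar>perturbation_term V n s x z * V z * gauss_kernel (t - s) z y\<bar>
          \<le> (C * gauss_kernel s x z) * \<bar>V z\<bar> * gauss_kernel (t - s) z y"
          using bd[of s z] True by (simp add: abs_mult mult_right_mono)
        then show "ennreal \<bar>perturbation_term V n s x z * V z * gauss_kernel (t - s) z y\<bar>
          \<le> ennreal C * ennreal (gauss_kernel s x z * \<bar>V z\<bar> * gauss_kernel (t - s) z y)"
          using \<open>0 \<le> C\<close> by (simp add: ennreal_mult [symmetric] mult.assoc ennreal_leI)
      qed
      also have "\<dots> = ennreal C * (\<integral>\<^sup>+z. ennreal (gauss_kernel s x z * \<bar>V z\<bar> * gauss_kernel (t - s) z y) \<partial>lborel)"
        by (rule nn_integral_cmult) measurable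
      finally show ?thesis using True by simp
    qed (auto simp: indicator_greaterThanLessThan_eq)
  qed
  also have "\<dots> = ennreal C * kato_integral V t x y"
    unfolding kato_integral_def
    by (rule nn_integral_cmult) (simp add: indicator_greaterThanLessThan_eq)
  finally show ?thesis .
qed

lemma perturbation_term_bound:
  fixes V :: "'c::euclidean_space \<Rightarrow> real"
  assumes V: "V \<in> borel_measurable borel" and M: "0 \<le> M"
    and kato: "\<And>t x y. 0 < t \<Longrightarrow> t \<le> T \<Longrightarrow> kato_integral V t x y \<le> ennreal (M * gauss_kernel t x y)"
  shows "0 < t \<Longrightarrow> t \<le> T \<Longrightarrow> \<bar>perturbation_term V n t x y\<bar> \<le> M ^ n * gauss_kernel t x y"
proof (induction n arbitrary: t x y)
  case (Suc n)
  have "ennreal \<bar>perturbation_term V (Suc n) t x y\<bar> \<le> ennreal (M ^ n) * kato_integral V t x y"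
    using Suc M by (intro perturbation_term_Suc_kato_bound[OF V]) auto
  also have "\<dots> \<le> ennreal (M ^ n) * ennreal (M * gauss_kernel t x y)"
    using Suc by (intro mult_left_mono kato) auto
  also have "\<dots> = ennreal (M ^ Suc n * gauss_kernel t x y)"
    using M by (simp add: ennreal_mult [symmetric] mult_ac)
  finally show ?case
    using M by (subst (asm) ennreal_le_iff) auto
qed simp

lemma kato_integral_eq_pair:
  fixes V :: "'c::euclidean_space \<Rightarrow> real"
  assumes V [measurable]: "V \<in> borel_measurable borel"
  shows "kato_integral V t x y = (\<integral>\<^sup>+p. ennreal (indicator {0<..<t} (fst p) *
    (gauss_kernel (fst p) x (snd p) * \<bar>V (snd p)\<bar> * gauss_kernel (t - fst p) (snd p) y)) \<partial>lborel)"
proof -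
  have "(\<integral>\<^sup>+p. ennreal (indicator {0<..<t} (fst p) *
    (gauss_kernel (fst p) x (snd p) * \<bar>V (snd p)\<bar> * gauss_kernel (t - fst p) (snd p) y)) \<partial>lborel)
    = (\<integral>\<^sup>+s. \<integral>\<^sup>+z. ennreal (indicator {0<..<t} s *
    (gauss_kernel s x z * \<bar>V z\<bar> * gauss_kernel (t - s) z y)) \<partial>lborel \<partial>lborel)"
    unfolding lborel_prod [symmetric] indicator_greaterThanLessThan_eq
    by (subst lborel.nn_integral_fst [symmetric]) auto
  also have "\<dots> = kato_integral V t x y"
    unfolding kato_integral_def by (intro nn_integral_cong) (auto simp: indicator_def)
  finally show ?thesis ..
qed

text \<open>Turns an iterated Duhamel integral into one integral over space-time, the form to which
  Fubini with a further variable applies. The integrand is dominated by C times that of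
  \<open>kato_integral V t x y\<close>.\<close>

lemma
  fixes V :: "'c::euclidean_space \<Rightarrow> real"
  assumes V [measurable]: "V \<in> borel_measurable borel"
    and F [measurable]: "(\<lambda>p. F (fst p) (snd p)) \<in> borel_measurable (borel :: (real \<times> 'c) measure)"
    and C: "0 \<le> C" "\<And>s z. 0 < s \<Longrightarrow> s < t \<Longrightarrow> \<bar>F s z\<bar> \<le> C * gauss_kernel s x z"
    and fin: "kato_integral V t x y < top"
  shows integrable_pair: "integrable lborel (\<lambda>p. indicator {0<..<t} (fst p) *
      (F (fst p) (snd p) * V (snd p) * gauss_kernel (t - fst p) (snd p) y))"
    and integral_pair: "(LINT s:{0<..<t}|lborel. LINT z|lborel. F s z * V z * gauss_kernel (t - s) z y)
      = (LINT p|lborel. indicator {0<..<t} (fst p) *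
      (F (fst p) (snd p) * V (snd p) * gauss_kernel (t - fst p) (snd p) y))"
proof -
  let ?R = "\<lambda>p. indicator {0<..<t} (fst p) *
      (F (fst p) (snd p) * V (snd p) * gauss_kernel (t - fst p) (snd p) y)"
  show int: "integrable lborel ?R"
  proof (rule integrableI_bounded)
    show "?R \<in> borel_measurable lborel"
      unfolding indicator_greaterThanLessThan_eq by measurable
    have "(\<integral>\<^sup>+p. ennreal (norm (?R p)) \<partial>lborel) \<le> (\<integral>\<^sup>+p. ennreal C * ennreal (indicator {0<..<t} (fst p) *
    (gauss_kernel (fst p) x (snd p) * \<bar>V (snd p)\<bar> * gauss_kernel (t - fst p) (snd p) y)) \<partial>lborel)"
    proof (intro nn_integral_mono)
      fix p :: "real \<times> 'c"
      have "norm (?R p) \<le> indicator {0<..<t} (fst p) *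
          ((C * gauss_kernel (fst p) x (snd p)) * \<bar>V (snd p)\<bar> * gauss_kernel (t - fst p) (snd p) y)"
        using C(2)[of "fst p" "snd p"] by (auto simp: indicator_def abs_mult intro!: mult_right_mono)
      then show "ennreal (norm (?R p)) \<le> ennreal C * ennreal (indicator {0<..<t} (fst p) *
    (gauss_kernel (fst p) x (snd p) * \<bar>V (snd p)\<bar> * gauss_kernel (t - fst p) (snd p) y))"
        using C(1) by (simp add: ennreal_mult [symmetric] ennreal_leI mult_ac)
    qed
    also have "\<dots> = ennreal C * kato_integral V t x y"
      unfolding kato_integral_eq_pair[OF V]
      by (rule nn_integral_cmult) (simp add: indicator_greaterThanLessThan_eq)
    also have "\<dots> < \<infinity>" using fin by (simp add: ennreal_mult_less_top)
    finally show "(\<integral>\<^sup>+p. ennreal (norm (?R p)) \<partial>lborel) < \<infinity>" .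
  qed
  have "(LINT p|lborel. ?R p) = (LINT s|lborel. LINT z|lborel. ?R (s, z))"
    using lborel_pair.integral_fst'[of ?R] int unfolding lborel_prod by simp
  also have "\<dots> = (LINT s:{0<..<t}|lborel. LINT z|lborel. F s z * V z * gauss_kernel (t - s) z y)"
    by (simp add: set_lebesgue_integral_def)
  finally show "(LINT s:{0<..<t}|lborel. LINT z|lborel. F s z * V z * gauss_kernel (t - s) z y)
      = (LINT p|lborel. ?R p)" ..
qed

text \<open>Tonelli's criterion. In the applications p is a space-time point, z an intermediate
  position, and K arises by integrating z out with the semigroup law.\<close>

lemma integrable_pair_of_section_bound:
  fixes H :: "'p::euclidean_space \<Rightarrow> 'z::euclidean_space \<Rightarrow> real" and K :: "'p \<Rightarrow> real"
  assumes [measurable]: "case_prod H \<in> borel_measurable (borel \<Otimes>\<^sub>M borel)"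
    and K: "integrable lborel K"
    and le: "\<And>p. (\<integral>\<^sup>+z. ennreal \<bar>H p z\<bar> \<partial>lborel) \<le> ennreal \<bar>K p\<bar>"
  shows "integrable (lborel \<Otimes>\<^sub>M lborel) (case_prod H)"
proof (rule integrableI_bounded)
  have "(\<integral>\<^sup>+q. ennreal (norm (case_prod H q)) \<partial>(lborel \<Otimes>\<^sub>M lborel)) = (\<integral>\<^sup>+p. \<integral>\<^sup>+z. ennreal \<bar>H p z\<bar> \<partial>lborel \<partial>lborel)"
    by (subst lborel.nn_integral_fst [symmetric]) (auto simp: case_prod_beta)
  also have "\<dots> \<le> (\<integral>\<^sup>+p. ennreal \<bar>K p\<bar> \<partial>lborel)"
    by (intro nn_integral_mono le)
  also have "\<dots> < \<infinity>" using K by (simp add: integrable_iff_bounded)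
  finally show "(\<integral>\<^sup>+q. ennreal (norm (case_prod H q)) \<partial>(lborel \<Otimes>\<^sub>M lborel)) < \<infinity>" .
qed measurable

lemma
  fixes f :: "'p::euclidean_space \<Rightarrow> real"
  assumes f: "integrable lborel f"
  shows integrable_lborel_translate: "integrable lborel (\<lambda>p. f (c + p))"
    and integral_lborel_translate: "(LINT p|lborel. f (c + p)) = (LINT p|lborel. f p)"
proof -
  have [measurable]: "f \<in> borel_measurable borel" using f by simp
  show "integrable lborel (\<lambda>p. f (c + p))"
    using f integrable_distr_eq[of "(+) c" lborel borel f] by (simp add: lborel_distr_plus)
  show "(LINT p|lborel. f (c + p)) = (LINT p|lborel. f p)"
    using integral_distr[of "(+) c" lborel borel f] by (simp add: lborel_distr_plus)
qed

lemma integrable_gauss_kernel_dominated: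
  fixes A B :: "'c::euclidean_space \<Rightarrow> real"
  assumes [measurable]: "A \<in> borel_measurable borel" "B \<in> borel_measurable borel"
    and "0 < s" "0 < t" "0 \<le> C" "0 \<le> D"
    and A: "\<And>z. \<bar>A z\<bar> \<le> C * gauss_kernel s x z" and B: "\<And>z. \<bar>B z\<bar> \<le> D * gauss_kernel t z y"
  shows "integrable lborel (\<lambda>z. A z * B z)"
proof (rule Bochner_Integration.integrable_bound)
  show "integrable lborel (\<lambda>z. (C * D) * (gauss_kernel s x z * gauss_kernel t z y))"
    using assms by (intro integrable_mult_right integrable_gauss_kernel_semigroup)
  have "\<bar>A z\<bar> * \<bar>B z\<bar> \<le> (C * gauss_kernel s x z) * (D * gauss_kernel t z y)" for z
    using A[of z] B[of z] assms by (intro mult_mono) auto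
  then show "AE z in lborel. norm (A z * B z) \<le> norm ((C * D) * (gauss_kernel s x z * gauss_kernel t z y))"
    using assms by (intro AE_I2) (simp add: abs_mult mult_ac)
qed measurable

text \<open>The two properties of V on which the perturbation argument rests. The threshold 1/4 is
  the ratio of the geometric series that dominates the perturbation series at short times, and it is
  tied to the constant 4 in the exponent of the lower bound.\<close>

locale kato_potential =
  fixes V :: "'c::euclidean_space \<Rightarrow> real"
  assumes V_measurable [measurable]: "V \<in> borel_measurable borel"
    and kato_bounded: "0 < T \<Longrightarrow> \<exists>M\<ge>0. \<forall>t x y. 0 < t \<and> t \<le> T \<longrightarrow>
      kato_integral V t x y \<le> ennreal (M * gauss_kernel t x y)"
    and kato_small: "\<exists>T>0. \<forall>t x y. 0 < t \<and> t \<le> T \<longrightarrow>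
      kato_integral V t x y \<le> ennreal (1 / 4 * gauss_kernel t x y)"
begin

section \<open>The Chapman-Kolmogorov equation for the single terms\<close>

lemma kato_integral_finite: "0 < t \<Longrightarrow> kato_integral V t x y < top"
  using kato_bounded[of t] by (metis ennreal_less_top order_le_less_trans order_refl)

lemma perturbation_term_bounded:
  assumes "0 < T"
  shows "\<exists>C\<ge>0. \<forall>t x y. 0 < t \<and> t \<le> T \<longrightarrow> \<bar>perturbation_term V n t x y\<bar> \<le> C * gauss_kernel t x y"
proof -
  obtain M where "0 \<le> M" "\<And>t x y. 0 < t \<Longrightarrow> t \<le> T \<Longrightarrow> kato_integral V t x y \<le> ennreal (M * gauss_kernel t x y)"
    using kato_bounded[OF assms] by blast
  from perturbation_term_bound[OF V_measurable this] \<open>0 \<le> M\<close> show ?thesis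
    by (intro exI[of _ "M ^ n"]) auto
qed

lemma perturbation_term_boundedE:
  assumes "0 < T"
  obtains C where "0 \<le> C"
    "\<And>t x y. 0 < t \<Longrightarrow> t \<le> T \<Longrightarrow> \<bar>perturbation_term V n t x y\<bar> \<le> C * gauss_kernel t x y"
  using perturbation_term_bounded[OF assms] by blast

text \<open>The case of a last interaction before time s: the free evolution over s - \<sigma> is
  followed by one over t, and once z is integrated first, the two kernels merge into g(s + t -
  \<sigma>).\<close>

lemma integral_duhamel_mult_gauss_kernel:
  assumes [measurable]: "(\<lambda>p. F (fst p) (snd p)) \<in> borel_measurable (borel :: (real \<times> 'c) measure)"
    and st: "0 < s" "0 < t"
    and C: "0 \<le> C" "\<And>\<sigma> w. 0 < \<sigma> \<Longrightarrow> \<sigma> < s \<Longrightarrow> \<bar>F \<sigma> w\<bar> \<le> C * gauss_kernel \<sigma> x w"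
  shows "(LINT z|lborel. (LINT \<sigma>:{0<..<s}|lborel. LINT w|lborel. F \<sigma> w * V w * gauss_kernel (s - \<sigma>) w z) * gauss_kernel t z y)
      = (LINT p|lborel. indicator {0<..<s} (fst p) *
        (F (fst p) (snd p) * V (snd p) * gauss_kernel (s + t - fst p) (snd p) y))" (is "?L = ?R")
proof -
  \<comment> \<open>The bound on F holds only before time s, while \<open>integrable_pair\<close>
    with final time s + t asks for it up to s + t; cutting F off at s supplies this.\<close>
  define F' where "F' = (\<lambda>\<sigma> w. if \<sigma> < s then F \<sigma> w else 0)"
  have [measurable]: "(\<lambda>p. F' (fst p) (snd p)) \<in> borel_measurable (borel :: (real \<times> 'c) measure)"
    unfolding F'_def by measurable
  define K where "K = (\<lambda>p. indicator {0<..<s} (fst p) *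
        (F (fst p) (snd p) * V (snd p) * gauss_kernel (s + t - fst p) (snd p) y))"
  have "integrable lborel (\<lambda>p. indicator {0<..<s + t} (fst p) *
        (F' (fst p) (snd p) * V (snd p) * gauss_kernel (s + t - fst p) (snd p) y))"
    using C st by (intro integrable_pair[of V F' C "s + t" x] kato_integral_finite) (auto simp: F'_def)
  also have "(\<lambda>p. indicator {0<..<s + t} (fst p) *
        (F' (fst p) (snd p) * V (snd p) * gauss_kernel (s + t - fst p) (snd p) y)) = K"
    using st by (auto simp: F'_def K_def indicator_def)
  finally have K: "integrable lborel K" .
  define H where "H = (\<lambda>p z. indicator {0<..<s} (fst p) *
        (F (fst p) (snd p) * V (snd p) * gauss_kernel (s - fst p) (snd p) z) * gauss_kernel t z y)"
  have H_eq: "H p z = (indicator {0<..<s} (fst p) * F (fst p) (snd p) * V (snd p)) *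
      (gauss_kernel (s - fst p) (snd p) z * gauss_kernel t z y)" for p z
    by (simp add: H_def)
  have e: "s - r + t = s + t - r" for r by simp
  have int: "integrable (lborel \<Otimes>\<^sub>M lborel) (case_prod H)"
  proof (rule integrable_pair_of_section_bound[OF _ K])
    show "case_prod H \<in> borel_measurable (borel \<Otimes>\<^sub>M borel)"
      unfolding H_def indicator_greaterThanLessThan_eq by measurable
    fix p :: "real \<times> 'c"
    show "(\<integral>\<^sup>+z. ennreal \<bar>H p z\<bar> \<partial>lborel) \<le> ennreal \<bar>K p\<bar>"
    proof (cases "fst p \<in> {0<..<s}")
      case True
      then show ?thesis
        using st nn_integral_cmult_gauss_kernel_semigroup[of "s - fst p" t "\<bar>F (fst p) (snd p)\<bar> * \<bar>V (snd p)\<bar>" "snd p" y]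
        unfolding H_eq K_def by (simp add: abs_mult e mult.assoc)
    qed (auto simp: H_def)
  qed
  have "?L = (LINT z|lborel. LINT p|lborel. H p z)"
  proof (intro Bochner_Integration.integral_cong refl)
    fix z
    show "(LINT \<sigma>:{0<..<s}|lborel. LINT w|lborel. F \<sigma> w * V w * gauss_kernel (s - \<sigma>) w z) * gauss_kernel t z y
      = (LINT p|lborel. H p z)"
      unfolding H_def using C st
      by (subst integral_pair[of V F C s x z]) (auto simp: kato_integral_finite)
  qed
  also have "\<dots> = (LINT p|lborel. LINT z|lborel. H p z)"
    using int by (rule lborel_pair.Fubini_integral)
  also have "\<dots> = (LINT p|lborel. K p)"
  proof (intro Bochner_Integration.integral_cong refl)
    fix p :: "real \<times> 'c"
    show "(LINT z|lborel. H p z) = K p"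
    proof (cases "fst p \<in> {0<..<s}")
      case True
      then show ?thesis
        using st unfolding H_eq
        by (simp add: integral_gauss_kernel_semigroup K_def e)
    qed (auto simp: H_def K_def)
  qed
  finally show ?thesis unfolding K_def .
qed

text \<open>The case of a last interaction after time s, with \<sigma> the time elapsed since s: A
  carries the path up to s, and B from s to the interaction. Integrating z first leaves the Duhamel
  integrand of the composite of A and B.\<close>

lemma integral_mult_duhamel:
  assumes [measurable]: "A \<in> borel_measurable borel"
      "(\<lambda>q. B (fst q) (fst (snd q)) (snd (snd q))) \<in> borel_measurable (borel :: (real \<times> 'c \<times> 'c) measure)"
    and st: "0 < s" "0 < t"
    and C: "0 \<le> C" "\<And>z. \<bar>A z\<bar> \<le> C * gauss_kernel s x z"
    and D: "0 \<le> D" "\<And>\<sigma> z w. 0 < \<sigma> \<Longrightarrow> \<sigma> < t \<Longrightarrow> \<bar>B \<sigma> z w\<bar> \<le> D * gauss_kernel \<sigma> z w"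
  shows "(LINT z|lborel. A z * (LINT \<sigma>:{0<..<t}|lborel. LINT w|lborel. B \<sigma> z w * V w * gauss_kernel (t - \<sigma>) w y))
      = (LINT p|lborel. indicator {0<..<t} (fst p) *
        ((LINT z|lborel. A z * B (fst p) z (snd p)) * V (snd p) * gauss_kernel (t - fst p) (snd p) y))" (is "?L = ?R")
    and "integrable lborel (\<lambda>p. indicator {0<..<t} (fst p) *
        ((LINT z|lborel. A z * B (fst p) z (snd p)) * V (snd p) * gauss_kernel (t - fst p) (snd p) y))"
proof -
  note borel_measurable_compose3[OF assms(2), measurable (raw)]
  \<comment> \<open>Integrating |A| |B| over z gives at most C D g(s + \<sigma>, x, w) by the
    semigroup law. So the majorant is a Duhamel integrand on (0, s + t), restricted to times after s
    and shifted back by s: h is the restricted function, and K, up to the factor C D, the shifted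
    one.\<close>
  define h where "h = (\<lambda>p. indicator {0<..<s + t} (fst p) *
        ((indicator {s<..<s + t} (fst p) * gauss_kernel (fst p) x (snd p)) * V (snd p) * gauss_kernel (s + t - fst p) (snd p) y))"
  have h: "integrable lborel h"
    unfolding h_def using st
  proof (intro integrable_pair[of V "\<lambda>\<sigma> w. indicator {s<..<s + t} \<sigma> * gauss_kernel \<sigma> x w" 1 "s + t" x] kato_integral_finite)
    show "(\<lambda>p. indicator {s<..<s + t} (fst p) * gauss_kernel (fst p) x (snd p)) \<in> borel_measurable borel"
      unfolding indicator_greaterThanLessThan_eq by (simp add: indicator_def)
  qed (auto simp: indicator_def)
  define K where "K = (\<lambda>p. C * D * h ((s, 0) + p))"
  have K: "integrable lborel K"
    unfolding K_def by (intro integrable_mult_right integrable_lborel_translate h)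
  have K_eq: "K p = C * D * (indicator {0<..<t} (fst p) *
        (gauss_kernel (s + fst p) x (snd p) * V (snd p) * gauss_kernel (t - fst p) (snd p) y))" for p
    using st by (auto simp: K_def h_def indicator_def)
  define H where "H = (\<lambda>p z. A z * (indicator {0<..<t} (fst p) *
        (B (fst p) z (snd p) * V (snd p) * gauss_kernel (t - fst p) (snd p) y)))"
  have int: "integrable (lborel \<Otimes>\<^sub>M lborel) (case_prod H)"
  proof (rule integrable_pair_of_section_bound[OF _ K])
    show "case_prod H \<in> borel_measurable (borel \<Otimes>\<^sub>M borel)"
      unfolding H_def indicator_greaterThanLessThan_eq by measurable
    fix p :: "real \<times> 'c"
    show "(\<integral>\<^sup>+z. ennreal \<bar>H p z\<bar> \<partial>lborel) \<le> ennreal \<bar>K p\<bar>"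
    proof (cases "fst p \<in> {0<..<t}")
      case True
      define E where "E = C * D * \<bar>V (snd p)\<bar> * gauss_kernel (t - fst p) (snd p) y"
      have E: "0 \<le> E" using C D by (simp add: E_def)
      have "\<bar>H p z\<bar> \<le> E * (gauss_kernel s x z * gauss_kernel (fst p) z (snd p))" for z
      proof -
        have "\<bar>A z\<bar> * \<bar>B (fst p) z (snd p)\<bar> \<le> (C * gauss_kernel s x z) * (D * gauss_kernel (fst p) z (snd p))"
          using C D True by (intro mult_mono) auto
        then have "(\<bar>A z\<bar> * \<bar>B (fst p) z (snd p)\<bar>) * (\<bar>V (snd p)\<bar> * gauss_kernel (t - fst p) (snd p) y)
          \<le> ((C * gauss_kernel s x z) * (D * gauss_kernel (fst p) z (snd p))) * (\<bar>V (snd p)\<bar> * gauss_kernel (t - fst p) (snd p) y)"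
          by (rule mult_right_mono) simp
        then show ?thesis using True by (simp add: H_def E_def abs_mult mult_ac)
      qed
      then have "(\<integral>\<^sup>+z. ennreal \<bar>H p z\<bar> \<partial>lborel)
          \<le> (\<integral>\<^sup>+z. ennreal (E * (gauss_kernel s x z * gauss_kernel (fst p) z (snd p))) \<partial>lborel)"
        by (intro nn_integral_mono ennreal_leI)
      also have "\<dots> = ennreal (E * gauss_kernel (s + fst p) x (snd p))"
        using st True E by (intro nn_integral_cmult_gauss_kernel_semigroup) auto
      also have "E * gauss_kernel (s + fst p) x (snd p) = \<bar>K p\<bar>"
        using True C D by (simp add: K_eq E_def abs_mult mult_ac)
      finally show ?thesis .
    qed (auto simp: H_def)
  qed
  have inner: "(LINT z|lborel. H p z) = indicator {0<..<t} (fst p) *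
        ((LINT z|lborel. A z * B (fst p) z (snd p)) * V (snd p) * gauss_kernel (t - fst p) (snd p) y)" for p
  proof -
    have "(LINT z|lborel. H p z) = (LINT z|lborel. (A z * B (fst p) z (snd p)) *
       (indicator {0<..<t} (fst p) * V (snd p) * gauss_kernel (t - fst p) (snd p) y))"
      by (simp add: H_def mult_ac)
    then show ?thesis by simp
  qed
  have "?L = (LINT z|lborel. LINT p|lborel. H p z)"
  proof (intro Bochner_Integration.integral_cong refl)
    fix z
    have "(LINT \<sigma>:{0<..<t}|lborel. LINT w|lborel. B \<sigma> z w * V w * gauss_kernel (t - \<sigma>) w y)
      = (LINT p|lborel. indicator {0<..<t} (fst p) * (B (fst p) z (snd p) * V (snd p) * gauss_kernel (t - fst p) (snd p) y))"
      using D st by (intro integral_pair[of V "\<lambda>\<sigma> w. B \<sigma> z w" D t z y]) (auto simp: kato_integral_finite)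
    then show "A z * (LINT \<sigma>:{0<..<t}|lborel. LINT w|lborel. B \<sigma> z w * V w * gauss_kernel (t - \<sigma>) w y)
      = (LINT p|lborel. H p z)"
      by (simp add: H_def)
  qed
  also have "\<dots> = (LINT p|lborel. LINT z|lborel. H p z)"
    using int by (rule lborel_pair.Fubini_integral)
  finally show "?L = ?R" unfolding inner .
  show "integrable lborel (\<lambda>p. indicator {0<..<t} (fst p) *
        ((LINT z|lborel. A z * B (fst p) z (snd p)) * V (snd p) * gauss_kernel (t - fst p) (snd p) y))"
    using lborel_pair.integrable_fst'[OF int] by (simp add: inner)
qed

text \<open>The term of order n carries n interactions, and k counts those before time s. For order
  n + 1, Duhamel's formula is split by the time of the last interaction: if it is before s, all
  interactions are, which gives k = n + 1; if it is after s, the induction hypothesis at that time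
  gives k \<le> n.\<close>

lemma perturbation_term_chapman_kolmogorov:
  assumes "0 < s" "0 < t"
  shows "perturbation_term V n (s + t) x y
    = (\<Sum>k\<le>n. LINT z|lborel. perturbation_term V k s x z * perturbation_term V (n - k) t z y)"
  using assms
proof (induction n arbitrary: t y)
  case 0
  then show ?case by (simp add: integral_gauss_kernel_semigroup)
next
  case (Suc n)
  note st = \<open>0 < s\<close> \<open>0 < t\<close>
  let ?P = "perturbation_term V"
  obtain C where C: "0 \<le> C" "\<And>\<tau> x y. 0 < \<tau> \<Longrightarrow> \<tau> \<le> s + t \<Longrightarrow> \<bar>?P n \<tau> x y\<bar> \<le> C * gauss_kernel \<tau> x y"
    using perturbation_term_boundedE[of "s + t" n] st by auto
  define R where "R = (\<lambda>p. ?P n (fst p) x (snd p) * V (snd p) * gauss_kernel (s + t - fst p) (snd p) y)"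
  have intR: "integrable lborel (\<lambda>p. indicator {0<..<s + t} (fst p) * R p)"
    unfolding R_def using C st by (intro integrable_pair[of V _ C "s + t" x] kato_integral_finite) auto
  have [measurable]: "R \<in> borel_measurable borel"
    unfolding R_def by measurable
  have sub: "integrable lborel (\<lambda>p. indicator A (fst p) * R p)" if "A \<subseteq> {0<..<s + t}" "A \<in> sets borel" for A
  proof (rule Bochner_Integration.integrable_bound[OF intR])
    have [measurable]: "A \<in> sets borel" by fact
    show "(\<lambda>p. indicator A (fst p) * R p) \<in> borel_measurable lborel" by measurable
    show "AE p in lborel. norm (indicator A (fst p) * R p) \<le> norm (indicator {0<..<s + t} (fst p) * R p)"
      using that by (intro AE_I2) (auto simp: indicator_def)
  qed
  have T: "integrable lborel (\<lambda>p. indicator {0<..<t} (fst p) *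
        ((LINT z|lborel. ?P k s x z * ?P (n - k) (fst p) z (snd p)) * V (snd p) * gauss_kernel (t - fst p) (snd p) y))"
      "(LINT p|lborel. indicator {0<..<t} (fst p) *
        ((LINT z|lborel. ?P k s x z * ?P (n - k) (fst p) z (snd p)) * V (snd p) * gauss_kernel (t - fst p) (snd p) y))
        = (LINT z|lborel. ?P k s x z * ?P (Suc n - k) t z y)" if "k \<le> n" for k
  proof -
    obtain A where A: "0 \<le> A" "\<And>\<tau> x y. 0 < \<tau> \<Longrightarrow> \<tau> \<le> s \<Longrightarrow> \<bar>?P k \<tau> x y\<bar> \<le> A * gauss_kernel \<tau> x y"
      using perturbation_term_boundedE[of s k] st by auto
    obtain B where B: "0 \<le> B" "\<And>\<tau> x y. 0 < \<tau> \<Longrightarrow> \<tau> \<le> t \<Longrightarrow> \<bar>?P (n - k) \<tau> x y\<bar> \<le> B * gauss_kernel \<tau> x y"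
      using perturbation_term_boundedE[of t "n - k"] st by auto
    have e: "Suc n - k = Suc (n - k)" using that by simp
    have m: "(\<lambda>z. ?P k s x z) \<in> borel_measurable borel"
      "(\<lambda>q. ?P (n - k) (fst q) (fst (snd q)) (snd (snd q))) \<in> borel_measurable borel"
      by measurable
    note * = integral_mult_duhamel[OF m st A(1) _ B(1), of x y]
    show "integrable lborel (\<lambda>p. indicator {0<..<t} (fst p) *
        ((LINT z|lborel. ?P k s x z * ?P (n - k) (fst p) z (snd p)) * V (snd p) * gauss_kernel (t - fst p) (snd p) y))"
      using A B st by (intro *(2)) auto
    show "(LINT p|lborel. indicator {0<..<t} (fst p) *
        ((LINT z|lborel. ?P k s x z * ?P (n - k) (fst p) z (snd p)) * V (snd p) * gauss_kernel (t - fst p) (snd p) y))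
        = (LINT z|lborel. ?P k s x z * ?P (Suc n - k) t z y)"
      unfolding e perturbation_term.simps using A B st by (intro *(1) [symmetric]) auto
  qed
  have "?P (Suc n) (s + t) x y = (LINT p|lborel. indicator {0<..<s + t} (fst p) * R p)"
    unfolding R_def perturbation_term.simps
    using C st by (intro integral_pair[of V _ C "s + t" x] kato_integral_finite) auto
  also have "\<dots> = (LINT p|lborel. indicator {0<..<s} (fst p) * R p + indicator {s<..<s + t} (fst p) * R p)"
  proof (rule integral_cong_AE)
    \<comment> \<open>The two open intervals omit the time s itself, a null slice of
      space-time.\<close>
    have "AE p in (lborel \<Otimes>\<^sub>M lborel :: (real \<times> 'c) measure). fst p \<noteq> s"
    proof (rule lborel_pair.AE_pair_measure)
      show "{p \<in> space (lborel \<Otimes>\<^sub>M lborel). fst p \<noteq> s} \<in> sets (lborel \<Otimes>\<^sub>M lborel :: (real \<times> 'c) measure)"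
        by measurable
      show "AE \<sigma> in lborel. AE w in (lborel :: 'c measure). fst (\<sigma>, w) \<noteq> s"
        using AE_lborel_singleton[of s] by eventually_elim simp
    qed
    then have "AE p in (lborel :: (real \<times> 'c) measure). fst p \<noteq> s" unfolding lborel_prod .
    then show "AE p in lborel. indicator {0<..<s + t} (fst p) * R p
        = indicator {0<..<s} (fst p) * R p + indicator {s<..<s + t} (fst p) * R p"
      by eventually_elim (use st in \<open>auto simp: indicator_def\<close>)
  qed measurable
  also have "\<dots> = (LINT p|lborel. indicator {0<..<s} (fst p) * R p) + (LINT p|lborel. indicator {s<..<s + t} (fst p) * R p)"
    using st by (intro Bochner_Integration.integral_add sub) auto
  also have "(LINT p|lborel. indicator {0<..<s} (fst p) * R p) = (LINT z|lborel. ?P (Suc n) s x z * ?P 0 t z y)"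
    unfolding R_def perturbation_term.simps
    using st C by (intro integral_duhamel_mult_gauss_kernel [symmetric, of _ s t C x]) auto
  \<comment> \<open>Time is now counted from s, so that the induction hypothesis, general in t and
    y, applies to the term of order n at time s + \<open>fst p\<close>.\<close>
  also have "(LINT p|lborel. indicator {s<..<s + t} (fst p) * R p)
      = (LINT p|lborel. indicator {s<..<s + t} (fst ((s, 0) + p)) * R ((s, 0) + p))"
    using st by (intro integral_lborel_translate [symmetric] sub) auto
  also have "\<dots> = (LINT p|lborel. (\<Sum>k\<le>n. indicator {0<..<t} (fst p) *
        ((LINT z|lborel. ?P k s x z * ?P (n - k) (fst p) z (snd p)) * V (snd p) * gauss_kernel (t - fst p) (snd p) y)))"
  proof (intro Bochner_Integration.integral_cong refl)
    fix p :: "real \<times> 'c"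
    show "indicator {s<..<s + t} (fst ((s, 0) + p)) * R ((s, 0) + p) = (\<Sum>k\<le>n. indicator {0<..<t} (fst p) *
        ((LINT z|lborel. ?P k s x z * ?P (n - k) (fst p) z (snd p)) * V (snd p) * gauss_kernel (t - fst p) (snd p) y))"
    proof (cases "fst p \<in> {0<..<t}")
      case True
      then show ?thesis
        using st Suc.IH[of "fst p" "snd p"] by (simp add: R_def sum_distrib_right)
    qed (auto simp: indicator_def)
  qed
  also have "\<dots> = (\<Sum>k\<le>n. LINT z|lborel. ?P k s x z * ?P (Suc n - k) t z y)"
    by (subst Bochner_Integration.integral_sum) (auto simp: T)
  finally show ?case by simp
qed

end

section \<open>Absolute convergence and the Chapman-Kolmogorov equation of the sum\<close>

lemma borel_measurable_schroedinger_kernel [measurable (raw)]: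
  fixes V :: "'c::euclidean_space \<Rightarrow> real"
  assumes [measurable]: "V \<in> borel_measurable borel"
    "t \<in> borel_measurable M" "x \<in> borel_measurable M" "y \<in> borel_measurable M"
  shows "(\<lambda>w. schroedinger_kernel V (t w) (x w) (y w)) \<in> borel_measurable M"
  unfolding schroedinger_kernel_def by measurable

text \<open>The left side sums over the triangle i + j < N, which lies inside the square of the
  right side.\<close>

lemma sum_convolution_le:
  fixes a b :: "nat \<Rightarrow> real"
  assumes "\<And>n. 0 \<le> a n" "\<And>n. 0 \<le> b n"
  shows "(\<Sum>n<N. \<Sum>k\<le>n. a k * b (n - k)) \<le> (\<Sum>n<N. a n) * (\<Sum>n<N. b n)"
proof -
  have "(\<Sum>n<N. \<Sum>k\<le>n. a k * b (n - k)) = (\<Sum>(i, j)\<in>{(i, j). i + j < N}. a i * b j)"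
    by (rule sum.triangle_reindex [symmetric])
  also have "\<dots> \<le> (\<Sum>(i, j)\<in>{..<N} \<times> {..<N}. a i * b j)"
    using assms by (intro sum_mono2) auto
  also have "\<dots> = (\<Sum>n<N. a n) * (\<Sum>n<N. b n)"
    by (simp add: sum_product sum.cartesian_product)
  finally show ?thesis .
qed

text \<open>Halving t often enough brings it into the range where Q is proved directly. Q may speak
  of all pairs of points, or of all times up to a horizon t.\<close>

lemma time_doubling_induct [consumes 2, case_names small double]:
  fixes t :: real
  assumes "0 < t" "0 < T"
    and small: "\<And>t. 0 < t \<Longrightarrow> t \<le> T \<Longrightarrow> Q t"
    and double: "\<And>t. 0 < t \<Longrightarrow> Q t \<Longrightarrow> Q (t + t)"
  shows "Q t"
proof -
  obtain k where "t / T < 2 ^ k" using real_arch_pow[of 2 "t / T"] by auto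
  then have "t \<le> T * 2 ^ k" using \<open>0 < T\<close> by (simp add: field_simps)
  then show ?thesis using \<open>0 < t\<close>
  proof (induction k arbitrary: t)
    case 0
    then show ?case by (intro small) auto
  next
    case (Suc k)
    then have "Q (t / 2 + t / 2)" by (intro double Suc.IH) auto
    then show ?case by simp
  qed
qed

context kato_potential
begin

lemma integrable_perturbation_term_mult:
  assumes "0 < s" "0 < t"
  shows "integrable lborel (\<lambda>z. perturbation_term V k s x z * perturbation_term V l t z y)"
proof -
  obtain A where A: "0 \<le> A" "\<And>\<tau> x y. 0 < \<tau> \<Longrightarrow> \<tau> \<le> s \<Longrightarrow> \<bar>perturbation_term V k \<tau> x y\<bar> \<le> A * gauss_kernel \<tau> x y"
    using perturbation_term_boundedE[of s k] assms by auto
  obtain B where B: "0 \<le> B" "\<And>\<tau> x y. 0 < \<tau> \<Longrightarrow> \<tau> \<le> t \<Longrightarrow> \<bar>perturbation_term V l \<tau> x y\<bar> \<le> B * gauss_kernel \<tau> x y"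
    using perturbation_term_boundedE[of t l] assms by auto
  show ?thesis
    using assms A B by (intro integrable_gauss_kernel_dominated[of _ _ s t A B x y]) auto
qed

text \<open>The number N of terms is fixed, so no convergence of the series is presupposed. The
  convolution involves only orders below N on either side, hence the bound at time t is used with
  the same N.\<close>

lemma sum_abs_perturbation_term_double:
  assumes "0 < t" "0 \<le> C"
    and bd: "\<And>x y. (\<Sum>n<N. \<bar>perturbation_term V n t x y\<bar>) \<le> C * gauss_kernel t x y"
  shows "(\<Sum>n<N. \<bar>perturbation_term V n (t + t) x y\<bar>) \<le> C\<^sup>2 * gauss_kernel (t + t) x y"
proof -
  let ?P = "perturbation_term V"
  have int: "integrable lborel (\<lambda>z. \<bar>?P k t x z\<bar> * \<bar>?P l t z y\<bar>)" for k l
    using integrable_abs[OF integrable_perturbation_term_mult[OF assms(1,1)]] by (simp add: abs_mult)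
  have "(\<Sum>n<N. \<bar>?P n (t + t) x y\<bar>) \<le> (\<Sum>n<N. \<Sum>k\<le>n. LINT z|lborel. \<bar>?P k t x z\<bar> * \<bar>?P (n - k) t z y\<bar>)"
  proof (intro sum_mono)
    fix n
    have "\<bar>?P n (t + t) x y\<bar> \<le> (\<Sum>k\<le>n. \<bar>LINT z|lborel. ?P k t x z * ?P (n - k) t z y\<bar>)"
      unfolding perturbation_term_chapman_kolmogorov[OF assms(1,1)] by (rule sum_abs)
    also have "\<dots> \<le> (\<Sum>k\<le>n. LINT z|lborel. \<bar>?P k t x z\<bar> * \<bar>?P (n - k) t z y\<bar>)"
      unfolding abs_mult [symmetric] by (intro sum_mono integral_abs_bound)
    finally show "\<bar>?P n (t + t) x y\<bar> \<le> (\<Sum>k\<le>n. LINT z|lborel. \<bar>?P k t x z\<bar> * \<bar>?P (n - k) t z y\<bar>)" .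
  qed
  also have "\<dots> = (LINT z|lborel. (\<Sum>n<N. \<Sum>k\<le>n. \<bar>?P k t x z\<bar> * \<bar>?P (n - k) t z y\<bar>))"
    by (subst Bochner_Integration.integral_sum; (intro Bochner_Integration.integrable_sum int)?)
       (subst Bochner_Integration.integral_sum; (intro int refl)?)
  also have "\<dots> \<le> (LINT z|lborel. C\<^sup>2 * (gauss_kernel t x z * gauss_kernel t z y))"
  proof (intro integral_mono Bochner_Integration.integrable_sum int integrable_mult_right
      integrable_gauss_kernel_semigroup assms(1))
    fix z
    have "(\<Sum>n<N. \<Sum>k\<le>n. \<bar>?P k t x z\<bar> * \<bar>?P (n - k) t z y\<bar>)
        \<le> (\<Sum>n<N. \<bar>?P n t x z\<bar>) * (\<Sum>n<N. \<bar>?P n t z y\<bar>)"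
      by (rule sum_convolution_le) auto
    also have "\<dots> \<le> (C * gauss_kernel t x z) * (C * gauss_kernel t z y)"
      using \<open>0 \<le> C\<close> by (intro mult_mono bd) (auto intro: sum_nonneg)
    finally show "(\<Sum>n<N. \<Sum>k\<le>n. \<bar>?P k t x z\<bar> * \<bar>?P (n - k) t z y\<bar>)
        \<le> C\<^sup>2 * (gauss_kernel t x z * gauss_kernel t z y)"
      by (simp add: power2_eq_square mult_ac)
  qed
  also have "\<dots> = C\<^sup>2 * gauss_kernel (t + t) x y"
    using assms by (simp add: integral_gauss_kernel_semigroup)
  finally show ?thesis .
qed

lemma kato_smallE:
  obtains T where "0 < T"
    "\<And>t x y. 0 < t \<Longrightarrow> t \<le> T \<Longrightarrow> kato_integral V t x y \<le> ennreal (1 / 4 * gauss_kernel t x y)"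
  using kato_small by blast

lemma sum_abs_perturbation_term_bounded:
  assumes "0 < T"
  shows "\<exists>C\<ge>0. \<forall>t x y N. 0 < t \<and> t \<le> T \<longrightarrow>
    (\<Sum>n<N. \<bar>perturbation_term V n t x y\<bar>) \<le> C * gauss_kernel t x y"
proof -
  obtain S where S: "0 < S"
    "\<And>t x y. 0 < t \<Longrightarrow> t \<le> S \<Longrightarrow> kato_integral V t x y \<le> ennreal (1 / 4 * gauss_kernel t x y)"
    using kato_smallE by blast
  \<comment> \<open>The induction variable is the horizon: a time t \<le> T + T has its half at most
    T, where the bound is already known.\<close>
  show ?thesis using \<open>0 < T\<close> \<open>0 < S\<close>
  proof (induction rule: time_doubling_induct)
    case (small T)
    have "(\<Sum>n<N. \<bar>perturbation_term V n t x y\<bar>) \<le> 4 / 3 * gauss_kernel t x y" if t: "0 < t" "t \<le> T" for t x y N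
    proof -
      have "(\<Sum>n<N. \<bar>perturbation_term V n t x y\<bar>) \<le> (\<Sum>n<N. (1 / 4) ^ n * gauss_kernel t x y)"
        using perturbation_term_bound[OF V_measurable _ S(2), where T = S] small t by (intro sum_mono) auto
      also have "\<dots> = (\<Sum>n<N. (1 / 4) ^ n) * gauss_kernel t x y"
        by (simp add: sum_distrib_right)
      also have "(\<Sum>n<N. (1 / 4 :: real) ^ n) * gauss_kernel t x y \<le> 4 / 3 * gauss_kernel t x y"
      proof (intro mult_right_mono)
        have "(\<Sum>n<N. (1 / 4 :: real) ^ n) = 4 / 3 - 4 / 3 * (1 / 4) ^ N"
          by (induction N) auto
        then show "(\<Sum>n<N. (1 / 4 :: real) ^ n) \<le> 4 / 3" by simp
      qed simp
      finally show ?thesis .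
    qed
    then show ?case by (intro exI[of _ "4 / 3"]) auto
  next
    case (double T)
    then obtain C where C: "0 \<le> C" "\<And>t x y N. 0 < t \<Longrightarrow> t \<le> T \<Longrightarrow>
      (\<Sum>n<N. \<bar>perturbation_term V n t x y\<bar>) \<le> C * gauss_kernel t x y" by blast
    have "(\<Sum>n<N. \<bar>perturbation_term V n t x y\<bar>) \<le> C\<^sup>2 * gauss_kernel t x y" if "0 < t" "t \<le> T + T" for t x y N
      using sum_abs_perturbation_term_double[of "t / 2" C N x y] C that by simp
    then show ?case by (intro exI[of _ "C\<^sup>2"]) auto
  qed
qed

lemma summable_abs_perturbation_term:
  assumes "0 < t"
  shows "summable (\<lambda>n. \<bar>perturbation_term V n t x y\<bar>)"
proof -
  obtain C where "\<And>N. (\<Sum>n<N. \<bar>perturbation_term V n t x y\<bar>) \<le> C * gauss_kernel t x y"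
    using sum_abs_perturbation_term_bounded[OF assms] assms by blast
  then show ?thesis
    by (intro summableI_nonneg_bounded[where x = "C * gauss_kernel t x y"]) auto
qed

lemma schroedinger_kernel_sums:
  assumes "0 < t"
  shows "(\<lambda>n. perturbation_term V n t x y) sums schroedinger_kernel V t x y"
  unfolding schroedinger_kernel_def
  using summable_rabs_cancel[OF summable_abs_perturbation_term[OF assms]] by (rule summable_sums)

lemma abs_schroedinger_kernel_bounded:
  assumes "0 < T"
  shows "\<exists>C\<ge>0. \<forall>t x y. 0 < t \<and> t \<le> T \<longrightarrow> \<bar>schroedinger_kernel V t x y\<bar> \<le> C * gauss_kernel t x y"
proof -
  obtain C where C: "0 \<le> C" "\<And>t x y N. 0 < t \<Longrightarrow> t \<le> T \<Longrightarrow>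
      (\<Sum>n<N. \<bar>perturbation_term V n t x y\<bar>) \<le> C * gauss_kernel t x y"
    using sum_abs_perturbation_term_bounded[OF assms] by blast
  have "\<bar>schroedinger_kernel V t x y\<bar> \<le> C * gauss_kernel t x y" if t: "0 < t" "t \<le> T" for t x y
    unfolding schroedinger_kernel_def
    using summable_rabs[OF summable_abs_perturbation_term[OF t(1)]]
      suminf_le_const[OF summable_abs_perturbation_term[OF t(1)] C(2)[OF t]]
    by (rule order_trans)
  then show ?thesis using C(1) by blast
qed

text \<open>The partial sums of the Cauchy product of the two series consist of the convolutions in
  the equation for the terms. They converge pointwise by absolute summability and are dominated by a
  multiple of the product of the two Gaussian kernels, so the limit passes under the
  integral.\<close>

lemma
  assumes "0 < s" "0 < t"
  shows schroedinger_kernel_chapman_kolmogorov: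
      "(LINT z|lborel. schroedinger_kernel V s x z * schroedinger_kernel V t z y) = schroedinger_kernel V (s + t) x y"
    and integrable_schroedinger_kernel_mult:
      "integrable lborel (\<lambda>z. schroedinger_kernel V s x z * schroedinger_kernel V t z y)"
proof -
  let ?P = "perturbation_term V"
  obtain A where A: "0 \<le> A" "\<And>x y N. (\<Sum>n<N. \<bar>?P n s x y\<bar>) \<le> A * gauss_kernel s x y"
    using sum_abs_perturbation_term_bounded[OF assms(1)] assms by blast
  obtain B where B: "0 \<le> B" "\<And>x y N. (\<Sum>n<N. \<bar>?P n t x y\<bar>) \<le> B * gauss_kernel t x y"
    using sum_abs_perturbation_term_bounded[OF assms(2)] assms by blast
  define S where "S = (\<lambda>N z. \<Sum>n<N. \<Sum>k\<le>n. ?P k s x z * ?P (n - k) t z y)"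
  define w where "w = (\<lambda>z. A * B * (gauss_kernel s x z * gauss_kernel t z y))"
  have lim: "(\<lambda>N. S N z) \<longlonglongrightarrow> schroedinger_kernel V s x z * schroedinger_kernel V t z y" for z
    using Cauchy_product_sums[of "\<lambda>n. ?P n s x z" "\<lambda>n. ?P n t z y"]
    by (simp add: S_def sums_def schroedinger_kernel_def summable_abs_perturbation_term assms)
  have bd: "norm (S N z) \<le> w z" for N z
  proof -
    have "norm (S N z) \<le> (\<Sum>n<N. \<Sum>k\<le>n. \<bar>?P k s x z\<bar> * \<bar>?P (n - k) t z y\<bar>)"
      unfolding S_def abs_mult [symmetric] real_norm_def by (intro order_trans[OF sum_abs] sum_mono sum_abs)
    also have "\<dots> \<le> (\<Sum>n<N. \<bar>?P n s x z\<bar>) * (\<Sum>n<N. \<bar>?P n t z y\<bar>)"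
      by (rule sum_convolution_le) auto
    also have "\<dots> \<le> (A * gauss_kernel s x z) * (B * gauss_kernel t z y)"
      using A(1) B(1) by (intro mult_mono A(2) B(2)) (auto intro: sum_nonneg)
    finally show ?thesis by (simp add: w_def mult_ac)
  qed
  have w: "integrable lborel w"
    unfolding w_def using assms by (intro integrable_mult_right integrable_gauss_kernel_semigroup)
  have meas: "(\<lambda>z. schroedinger_kernel V s x z * schroedinger_kernel V t z y) \<in> borel_measurable lborel"
    "S N \<in> borel_measurable lborel" for N
    unfolding S_def by measurable
  note dc = meas(1) meas(2) w AE_I2[OF lim] AE_I2[OF bd]
  have S: "(LINT z|lborel. S N z) = (\<Sum>n<N. ?P n (s + t) x y)" for N
    unfolding S_def perturbation_term_chapman_kolmogorov[OF assms]
    by (subst Bochner_Integration.integral_sum; (intro Bochner_Integration.integrable_sum integrable_perturbation_term_mult assms)?)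
       (subst Bochner_Integration.integral_sum; (intro integrable_perturbation_term_mult assms refl)?)
  have "(\<lambda>N. LINT z|lborel. S N z) \<longlonglongrightarrow> (LINT z|lborel. schroedinger_kernel V s x z * schroedinger_kernel V t z y)"
    by (rule integral_dominated_convergence[OF dc])
  moreover have "(\<lambda>N. LINT z|lborel. S N z) \<longlonglongrightarrow> schroedinger_kernel V (s + t) x y"
    unfolding S using schroedinger_kernel_sums[of "s + t" x y] assms by (simp add: sums_def)
  ultimately show "(LINT z|lborel. schroedinger_kernel V s x z * schroedinger_kernel V t z y) = schroedinger_kernel V (s + t) x y"
    by (rule LIMSEQ_unique)
  show "integrable lborel (\<lambda>z. schroedinger_kernel V s x z * schroedinger_kernel V t z y)"
    by (rule integrable_dominated_convergence[OF dc])
qed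

section \<open>The first-order term u of |V| as a real function, and the comparison of G with
  g\<close>

definition kato_kernel :: "real \<Rightarrow> 'c \<Rightarrow> 'c \<Rightarrow> real" where
  "kato_kernel t x y = enn2real (kato_integral V t x y)"

lemma kato_kernel_nonneg: "0 \<le> kato_kernel t x y"
  by (simp add: kato_kernel_def)

lemma kato_integral_eq_kato_kernel: "0 < t \<Longrightarrow> kato_integral V t x y = ennreal (kato_kernel t x y)"
  using kato_integral_finite[of t x y] by (simp add: kato_kernel_def)

lemma kato_kernel_leI:
  assumes "0 < t" "0 \<le> M" "kato_integral V t x y \<le> ennreal (M * gauss_kernel t x y)"
  shows "kato_kernel t x y \<le> M * gauss_kernel t x y"
  using assms by (simp add: kato_integral_eq_kato_kernel)

text \<open>\<open>kato_integral\<close> sees only |V|. Thus all results apply to the potential |V|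
  as well, and u becomes a perturbation term obeying the Chapman-Kolmogorov equation.\<close>

lemma kato_potential_abs: "kato_potential (\<lambda>z. \<bar>V z\<bar>)"
proof -
  have "kato_integral (\<lambda>z. \<bar>V z\<bar>) = kato_integral V"
    by (simp add: kato_integral_def fun_eq_iff)
  then show ?thesis
    using kato_bounded kato_small by unfold_locales auto
qed

lemma perturbation_term_abs_Suc_0:
  assumes "0 < t"
  shows "perturbation_term (\<lambda>z. \<bar>V z\<bar>) (Suc 0) t x y = kato_kernel t x y"
proof -
  have "perturbation_term (\<lambda>z. \<bar>V z\<bar>) (Suc 0) t x y = (LINT p|lborel. indicator {0<..<t} (fst p) *
      (gauss_kernel (fst p) x (snd p) * \<bar>V (snd p)\<bar> * gauss_kernel (t - fst p) (snd p) y))"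
    unfolding perturbation_term.simps
    using kato_potential.kato_integral_finite[OF kato_potential_abs assms]
    by (intro integral_pair[where C = 1 and x = x]) auto
  also have "\<dots> = kato_kernel t x y"
    unfolding kato_kernel_def kato_integral_eq_pair[OF V_measurable]
    by (rule integral_eq_nn_integral) (auto simp: indicator_greaterThanLessThan_eq)
  finally show ?thesis .
qed

text \<open>The order-one case of the equation for |V|. Divided by g(s + t, x, y), it says that the
  bridge averages of u / g over the two legs, from x to z and from z to y, add up to u / g from x to
  y.\<close>

lemma kato_kernel_chapman_kolmogorov:
  assumes "0 < s" "0 < t"
  shows "integrable lborel (\<lambda>z. kato_kernel s x z * gauss_kernel t z y)"
    and "integrable lborel (\<lambda>z. gauss_kernel s x z * kato_kernel t z y)"
    and "kato_kernel (s + t) x y = (LINT z|lborel. gauss_kernel s x z * kato_kernel t z y) + (LINT z|lborel. kato_kernel s x z * gauss_kernel t z y)"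
proof -
  interpret abs: kato_potential "\<lambda>z. \<bar>V z\<bar>" by (rule kato_potential_abs)
  have *: "perturbation_term (\<lambda>z. \<bar>V z\<bar>) (Suc 0) s x y = kato_kernel s x y"
     "perturbation_term (\<lambda>z. \<bar>V z\<bar>) (Suc 0) t x y = kato_kernel t x y"
     "perturbation_term (\<lambda>z. \<bar>V z\<bar>) (Suc 0) (s + t) x y = kato_kernel (s + t) x y" for x y
    using assms by (auto intro!: perturbation_term_abs_Suc_0 simp del: perturbation_term.simps)
  show "integrable lborel (\<lambda>z. kato_kernel s x z * gauss_kernel t z y)"
    using abs.integrable_perturbation_term_mult[OF assms, of "Suc 0" x 0 y] unfolding * by simp
  show "integrable lborel (\<lambda>z. gauss_kernel s x z * kato_kernel t z y)"
    using abs.integrable_perturbation_term_mult[OF assms, of 0 x "Suc 0" y] unfolding * by simp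
  show "kato_kernel (s + t) x y = (LINT z|lborel. gauss_kernel s x z * kato_kernel t z y) + (LINT z|lborel. kato_kernel s x z * gauss_kernel t z y)"
    using abs.perturbation_term_chapman_kolmogorov[OF assms, of "Suc 0" x y]
    by (simp add: * del: perturbation_term.simps(2))
qed

text \<open>The last integration is bounded by u and not by g / 4, so the whole series beyond g is
  controlled by a multiple of u.\<close>

lemma abs_perturbation_term_Suc_le:
  assumes S: "\<And>t x y. 0 < t \<Longrightarrow> t \<le> S \<Longrightarrow> kato_integral V t x y \<le> ennreal (1 / 4 * gauss_kernel t x y)"
    and t: "0 < t" "t \<le> S"
  shows "\<bar>perturbation_term V (Suc n) t x y\<bar> \<le> (1 / 4) ^ n * kato_kernel t x y"
proof -
  have "\<bar>perturbation_term V n s x z\<bar> \<le> (1 / 4) ^ n * gauss_kernel s x z" if "0 < s" "s < t" for s z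
    using that t by (intro perturbation_term_bound[OF V_measurable _ S]) auto
  then have "ennreal \<bar>perturbation_term V (Suc n) t x y\<bar> \<le> ennreal ((1 / 4) ^ n) * kato_integral V t x y"
    by (intro perturbation_term_Suc_kato_bound) auto
  also have "\<dots> = ennreal ((1 / 4) ^ n * kato_kernel t x y)"
    using t by (simp add: kato_integral_eq_kato_kernel ennreal_mult kato_kernel_nonneg)
  finally show ?thesis
    by (subst (asm) ennreal_le_iff) (auto simp: kato_kernel_nonneg)
qed

text \<open>The product (1 + 4 h) (1 - (4/3) h) equals 1 + (8/3) h - (16/3) h^2, which is at least 1
  for 0 \<le> h \<le> 1/4; and 1 + 4 h \<le> exp(4 h).\<close>

lemma exp_neg_4_le:
  fixes h :: real
  assumes "0 \<le> h" "h \<le> 1 / 4"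
  shows "exp (- 4 * h) \<le> 1 - 4 / 3 * h"
proof -
  have "1 \<le> (1 + 4 * h) * (1 - 4 / 3 * h)"
    using mult_left_mono[OF assms(2,1)] assms(1) by (simp add: algebra_simps)
  also have "\<dots> \<le> exp (4 * h) * (1 - 4 / 3 * h)"
    using assms by (intro mult_right_mono exp_ge_add_one_self) auto
  finally show ?thesis
    by (simp add: exp_minus field_simps)
qed

text \<open>At short times the terms of positive order contribute at least -(4/3) u, and
  \<open>exp_neg_4_le\<close> gives this the exponential form. In the doubling step convexity is
  used through an explicit tangent line, so that only integrals of products of u and g
  occur.\<close>

lemma schroedinger_kernel_lower_bound:
  assumes "0 < t"
  shows "gauss_kernel t x y * exp (- 4 * (kato_kernel t x y / gauss_kernel t x y)) \<le> schroedinger_kernel V t x y"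
proof -
  obtain S where S: "0 < S"
    "\<And>t x y. 0 < t \<Longrightarrow> t \<le> S \<Longrightarrow> kato_integral V t x y \<le> ennreal (1 / 4 * gauss_kernel t x y)"
    using kato_smallE by blast
  show ?thesis using \<open>0 < t\<close> S(1)
  proof (induction arbitrary: x y rule: time_doubling_induct)
    case (small t)
    let ?P = "\<lambda>n. perturbation_term V n t x y"
    have g: "0 < gauss_kernel t x y" using small by (intro gauss_kernel_pos)
    have ub: "kato_kernel t x y \<le> 1 / 4 * gauss_kernel t x y"
      using small by (intro kato_kernel_leI S) auto
    have le: "\<bar>?P (Suc n)\<bar> \<le> (1 / 4) ^ n * kato_kernel t x y" for n
      using abs_perturbation_term_Suc_le[OF S(2) small] .
    have geo: "(\<lambda>n. (1 / 4) ^ n * kato_kernel t x y) sums (4 / 3 * kato_kernel t x y)"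
      using sums_mult2[OF geometric_sums[of "1 / 4 :: real"], of "kato_kernel t x y"] by simp
    have "(\<lambda>n. ?P (Suc n)) sums (schroedinger_kernel V t x y - ?P 0)"
      using schroedinger_kernel_sums[OF small(1), of x y] by (subst sums_Suc_iff) simp
    then have "- (schroedinger_kernel V t x y - ?P 0) \<le> 4 / 3 * kato_kernel t x y"
    proof (intro sums_le[OF _ sums_minus geo])
      show "- ?P (Suc n) \<le> (1 / 4) ^ n * kato_kernel t x y" for n
        using le[of n] by linarith
    qed
    then have "gauss_kernel t x y * (1 - 4 / 3 * (kato_kernel t x y / gauss_kernel t x y)) \<le> schroedinger_kernel V t x y"
      using g by (simp add: right_diff_distrib)
    moreover have "exp (- 4 * (kato_kernel t x y / gauss_kernel t x y)) \<le> 1 - 4 / 3 * (kato_kernel t x y / gauss_kernel t x y)"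
      using g ub kato_kernel_nonneg by (intro exp_neg_4_le) (auto simp: field_simps)
    ultimately show ?case
      using g by (meson mult_left_mono order_trans less_imp_le)
  next
    case (double t)
    have g: "0 < gauss_kernel t x y" "0 < gauss_kernel (t + t) x y" for x y
      using double by (auto intro: gauss_kernel_pos)
    define m where "m = 4 * (kato_kernel (t + t) x y / gauss_kernel (t + t) x y)"
    \<comment> \<open>The tangent of exp(-a) at a = m is exp(-m) (1 + m - a). With a equal to 4
      times the sum of the two ratios u / g, h is this tangent weighted by the product of the two
      kernels, which cancels the denominators. Since m is the bridge mean of a, the integral of h is
      g exp(-m).\<close>
    define h where "h = (\<lambda>z. exp (- m) * ((1 + m) * (gauss_kernel t x z * gauss_kernel t z y)
        - 4 * (gauss_kernel t x z * kato_kernel t z y + kato_kernel t x z * gauss_kernel t z y)))"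
    note int = integrable_gauss_kernel_semigroup[OF double(1) double(1), of x y]
      kato_kernel_chapman_kolmogorov(1,2)[OF double(1) double(1), of x y]
    have "gauss_kernel (t + t) x y * exp (- m) =
        exp (- m) * ((1 + m) * gauss_kernel (t + t) x y - 4 * kato_kernel (t + t) x y)"
      using g(2)[of x y] by (simp add: m_def field_simps)
    also have "\<dots> = exp (- m) * ((1 + m) * (LINT z|lborel. gauss_kernel t x z * gauss_kernel t z y)
        - 4 * ((LINT z|lborel. gauss_kernel t x z * kato_kernel t z y) + (LINT z|lborel. kato_kernel t x z * gauss_kernel t z y)))"
      unfolding kato_kernel_chapman_kolmogorov(3)[OF double(1) double(1)] integral_gauss_kernel_semigroup[OF double(1) double(1)] ..
    also have "\<dots> = (LINT z|lborel. h z)"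
      unfolding h_def using int by simp
    also have "\<dots> \<le> (LINT z|lborel. schroedinger_kernel V t x z * schroedinger_kernel V t z y)"
    proof (intro integral_mono integrable_schroedinger_kernel_mult double(1))
      show "integrable lborel h" unfolding h_def using int by simp
      fix z
      define a where "a = 4 * (kato_kernel t x z / gauss_kernel t x z) + 4 * (kato_kernel t z y / gauss_kernel t z y)"
      have "exp (- m) * (1 + m - a) \<le> exp (- a)"
      proof -
        have "exp (- m) * (1 + (m - a)) \<le> exp (- m) * exp (m - a)"
          by (intro mult_left_mono exp_ge_add_one_self) auto
        then show ?thesis by (simp add: exp_add [symmetric] algebra_simps)
      qed
      then have "(gauss_kernel t x z * gauss_kernel t z y) * (exp (- m) * (1 + m - a))
          \<le> (gauss_kernel t x z * gauss_kernel t z y) * exp (- a)"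
        by (intro mult_left_mono) auto
      also have "\<dots> = (gauss_kernel t x z * exp (- 4 * (kato_kernel t x z / gauss_kernel t x z))) *
          (gauss_kernel t z y * exp (- 4 * (kato_kernel t z y / gauss_kernel t z y)))"
        by (simp add: a_def exp_add [symmetric] exp_diff field_simps)
      \<comment> \<open>Multiplying the two bounds requires G \<ge> 0 at time t, which the induction
        hypothesis provides, its left side being nonnegative.\<close>
      also have "\<dots> \<le> schroedinger_kernel V t x z * schroedinger_kernel V t z y"
        by (intro mult_mono double order_trans[OF _ double(2)]) auto
      also have "(gauss_kernel t x z * gauss_kernel t z y) * (exp (- m) * (1 + m - a)) = h z"
        using g(1)[of x z] g(1)[of z y] by (simp add: h_def a_def field_simps)
      finally show "h z \<le> schroedinger_kernel V t x z * schroedinger_kernel V t z y" .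
    qed
    also have "\<dots> = schroedinger_kernel V (t + t) x y"
      using double(1) by (intro schroedinger_kernel_chapman_kolmogorov)
    finally show ?case by (simp add: m_def)
  qed
qed

lemma schroedinger_kernel_nonneg: "0 < t \<Longrightarrow> 0 \<le> schroedinger_kernel V t x y"
  by (rule order_trans[OF _ schroedinger_kernel_lower_bound]) auto

text \<open>At short times the first-order term is -u, and the orders from 2 on add at most (1/4)
  (4/3) u = u / 3. The constant 1 is its own square, so doubling preserves it; multiplying the
  inequalities uses G \<ge> 0.\<close>

lemma schroedinger_kernel_le_gauss_kernel:
  assumes V: "\<And>z. V z \<le> 0" and "0 < t"
  shows "schroedinger_kernel V t x y \<le> gauss_kernel t x y"
proof -
  obtain S where S: "0 < S"
    "\<And>t x y. 0 < t \<Longrightarrow> t \<le> S \<Longrightarrow> kato_integral V t x y \<le> ennreal (1 / 4 * gauss_kernel t x y)"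
    using kato_smallE by blast
  show ?thesis using \<open>0 < t\<close> S(1)
  proof (induction arbitrary: x y rule: time_doubling_induct)
    case (small t)
    let ?P = "\<lambda>n. perturbation_term V n t x y"
    have "\<bar>V z\<bar> = - V z" for z using V[of z] by simp
    then have P1: "?P (Suc 0) = - kato_kernel t x y"
      by (simp add: perturbation_term_abs_Suc_0 [OF small(1), symmetric] set_lebesgue_integral_def)
    have le: "?P (Suc (Suc n)) \<le> (1 / 4) ^ n * (kato_kernel t x y / 4)" for n
      using abs_perturbation_term_Suc_le[OF S(2) small, of "Suc n" x y] by simp
    have geo: "(\<lambda>n. (1 / 4) ^ n * (kato_kernel t x y / 4)) sums (4 / 3 * (kato_kernel t x y / 4))"
      using sums_mult2[OF geometric_sums[of "1 / 4 :: real"], of "kato_kernel t x y / 4"] by simp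
    have "(\<lambda>n. ?P (Suc n)) sums (schroedinger_kernel V t x y - ?P 0)"
      using schroedinger_kernel_sums[OF small(1), of x y] by (subst sums_Suc_iff) simp
    then have "(\<lambda>n. ?P (Suc (Suc n))) sums (schroedinger_kernel V t x y - ?P 0 - ?P (Suc 0))"
      by (subst sums_Suc_iff) simp
    from sums_le[OF le this geo] show ?case
      using kato_kernel_nonneg[of t x y] unfolding P1 by simp
  next
    case (double t)
    have "schroedinger_kernel V (t + t) x y = (LINT z|lborel. schroedinger_kernel V t x z * schroedinger_kernel V t z y)"
      using double(1) by (intro schroedinger_kernel_chapman_kolmogorov [symmetric])
    also have "\<dots> \<le> (LINT z|lborel. gauss_kernel t x z * gauss_kernel t z y)"
      using double by (intro integral_mono integrable_schroedinger_kernel_mult integrable_gauss_kernel_semigroup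
          mult_mono schroedinger_kernel_nonneg) auto
    also have "\<dots> = gauss_kernel (t + t) x y"
      using double(1) by (intro integral_gauss_kernel_semigroup)
    finally show ?case .
  qed
qed

end

lemma (in kato_potential) schroedinger_kernel_quotient_ge:
  assumes "0 < t" "0 \<le> M" "kato_integral V t x y \<le> ennreal (M * gauss_kernel t x y)"
  shows "exp (- 4 * M) \<le> schroedinger_kernel V t x y / gauss_kernel t x y"
proof -
  have g: "0 < gauss_kernel t x y" using assms by (intro gauss_kernel_pos)
  have "kato_kernel t x y / gauss_kernel t x y \<le> M"
    using kato_kernel_leI[OF assms] g by (simp add: field_simps)
  then have "gauss_kernel t x y * exp (- 4 * M)
      \<le> gauss_kernel t x y * exp (- 4 * (kato_kernel t x y / gauss_kernel t x y))"
    by (intro mult_left_mono) auto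
  also have "\<dots> \<le> schroedinger_kernel V t x y"
    using assms by (intro schroedinger_kernel_lower_bound)
  finally show ?thesis using g by (simp add: field_simps)
qed

section \<open>Potentials with power bounds on Gaussian averages\<close>

text \<open>The bridge identity takes g(t, x, y) out of the inner integral and leaves a Gaussian
  average of |V| at kernel time s (t - s) / t. Its centre depends on x and y, which is why k bounds
  the averages uniformly in m.\<close>

lemma kato_integral_le_bridge:
  fixes V :: "'c::euclidean_space \<Rightarrow> real" and k :: "real \<Rightarrow> real"
  assumes [measurable]: "V \<in> borel_measurable borel" "k \<in> borel_measurable borel"
    and k: "\<And>\<tau> m. 0 < \<tau> \<Longrightarrow> (\<integral>\<^sup>+z. ennreal (gauss_kernel \<tau> m z * \<bar>V z\<bar>) \<partial>lborel) \<le> ennreal (k \<tau>)"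
  shows "kato_integral V t x y
    \<le> ennreal (gauss_kernel t x y) * (\<integral>\<^sup>+s. indicator {0<..<t} s * ennreal (k (s * (t - s) / t)) \<partial>lborel)"
proof -
  have "kato_integral V t x y \<le> (\<integral>\<^sup>+s. ennreal (gauss_kernel t x y) *
      (indicator {0<..<t} s * ennreal (k (s * (t - s) / t))) \<partial>lborel)"
    unfolding kato_integral_def
  proof (intro nn_integral_mono)
    fix s
    show "indicator {0<..<t} s * (\<integral>\<^sup>+z. ennreal (gauss_kernel s x z * \<bar>V z\<bar> * gauss_kernel (t - s) z y) \<partial>lborel)
      \<le> ennreal (gauss_kernel t x y) * (indicator {0<..<t} s * ennreal (k (s * (t - s) / t)))"
    proof (cases "s \<in> {0<..<t}")
      case True
      define m where "m = x + (s / t) *\<^sub>R (y - x)"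
      have "gauss_kernel s x z * \<bar>V z\<bar> * gauss_kernel (t - s) z y
          = gauss_kernel t x y * (gauss_kernel (s * (t - s) / t) m z * \<bar>V z\<bar>)" for z
        using gauss_kernel_bridge[of s t x z y] True by (simp add: m_def mult_ac)
      then have "(\<integral>\<^sup>+z. ennreal (gauss_kernel s x z * \<bar>V z\<bar> * gauss_kernel (t - s) z y) \<partial>lborel)
          = (\<integral>\<^sup>+z. ennreal (gauss_kernel t x y) * ennreal (gauss_kernel (s * (t - s) / t) m z * \<bar>V z\<bar>) \<partial>lborel)"
        by (simp only: ennreal_mult' gauss_kernel_nonneg)
      also have "\<dots> = ennreal (gauss_kernel t x y) * (\<integral>\<^sup>+z. ennreal (gauss_kernel (s * (t - s) / t) m z * \<bar>V z\<bar>) \<partial>lborel)"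
        by (rule nn_integral_cmult) measurable
      also have "\<dots> \<le> ennreal (gauss_kernel t x y) * ennreal (k (s * (t - s) / t))"
        using True by (intro mult_left_mono k) auto
      finally show ?thesis using True by simp
    qed simp
  qed
  also have "\<dots> = ennreal (gauss_kernel t x y) * (\<integral>\<^sup>+s. indicator {0<..<t} s * ennreal (k (s * (t - s) / t)) \<partial>lborel)"
    by (rule nn_integral_cmult) (simp add: indicator_greaterThanLessThan_eq)
  finally show ?thesis .
qed

text \<open>One of s and t - s is at least t / 2, so s (t - s) / t is at least half of the other,
  and k is nonincreasing. The sum of both candidates serves as a bound on the whole interval;
  reflecting s to t - s shows that they have the same integral, hence the factor 2.\<close>

lemma nn_integral_bridge_time_le:
  fixes k :: "real \<Rightarrow> real"
  assumes [measurable]: "k \<in> borel_measurable borel"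
    and nonneg: "\<And>\<tau>. 0 \<le> k \<tau>" and anti: "\<And>\<sigma> \<tau>. 0 < \<sigma> \<Longrightarrow> \<sigma> \<le> \<tau> \<Longrightarrow> k \<tau> \<le> k \<sigma>"
  shows "(\<integral>\<^sup>+s. indicator {0<..<t} s * ennreal (k (s * (t - s) / t)) \<partial>lborel)
    \<le> 2 * (\<integral>\<^sup>+s. indicator {0<..<t} s * ennreal (k (s / 2)) \<partial>lborel)"
proof -
  have [measurable]: "(\<lambda>s::real. indicator {0<..<t} s * ennreal (k (s / 2))) \<in> borel_measurable borel"
    by measurable
  have "(\<integral>\<^sup>+s. indicator {0<..<t} s * ennreal (k (s * (t - s) / t)) \<partial>lborel)
    \<le> (\<integral>\<^sup>+s. indicator {0<..<t} s * ennreal (k (s / 2)) + indicator {0<..<t} (t - s) * ennreal (k ((t - s) / 2)) \<partial>lborel)"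
  proof (intro nn_integral_mono)
    fix s
    show "indicator {0<..<t} s * ennreal (k (s * (t - s) / t))
      \<le> indicator {0<..<t} s * ennreal (k (s / 2)) + indicator {0<..<t} (t - s) * ennreal (k ((t - s) / 2))"
    proof (cases "0 < s \<and> s < t")
      case True
      have "k (s * (t - s) / t) \<le> k (s / 2) + k ((t - s) / 2)"
      proof (cases "s \<le> t / 2")
        case le: True
        have "s / 2 \<le> s * (t - s) / t"
          using mult_left_mono[of "t / 2" "t - s" s] True le by (simp add: field_simps)
        then show ?thesis using anti[of "s / 2"] True nonneg[of "(t - s) / 2"] by fastforce
      next
        case False
        have "(t - s) / 2 \<le> s * (t - s) / t"
          using mult_left_mono[of "t / 2" s "t - s"] True False by (simp add: field_simps)
        then show ?thesis using anti[of "(t - s) / 2"] True nonneg[of "s / 2"] by fastforce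
      qed
      then show ?thesis
        using True nonneg by (simp add: ennreal_plus [symmetric] ennreal_leI del: ennreal_plus)
    qed (auto simp: indicator_def)
  qed
  also have "\<dots> = (\<integral>\<^sup>+s. indicator {0<..<t} s * ennreal (k (s / 2)) \<partial>lborel)
      + (\<integral>\<^sup>+s. indicator {0<..<t} (t - s) * ennreal (k ((t - s) / 2)) \<partial>lborel)"
    by (rule nn_integral_add) (simp_all add: indicator_greaterThanLessThan_eq)
  also have "(\<integral>\<^sup>+s. indicator {0<..<t} (t - s) * ennreal (k ((t - s) / 2)) \<partial>lborel)
      = (\<integral>\<^sup>+s. indicator {0<..<t} s * ennreal (k (s / 2)) \<partial>lborel)"
    using nn_integral_real_affine[of "\<lambda>s. indicator {0<..<t} s * ennreal (k (s / 2))" "-1" t] by simp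
  finally show ?thesis by (simp add: mult_2)
qed

section \<open>Power integrals in time and the resulting bounds on the first-order term\<close>

lemma nn_integral_powr_from_0:
  fixes \<alpha> t C :: real
  assumes "\<alpha> < 1" "0 \<le> t" "0 \<le> C"
  shows "(\<integral>\<^sup>+s. indicator {0<..<t} s * ennreal (C * s powr (- \<alpha>)) \<partial>lborel) \<le> ennreal (C * t powr (1 - \<alpha>) / (1 - \<alpha>))"
proof -
  have "((\<lambda>s. C * s powr (- \<alpha>)) has_integral C * (t powr (- \<alpha> + 1) / (- \<alpha> + 1))) {0..t}"
    using assms by (intro has_integral_mult_right has_integral_powr_from_0) auto
  then have *: "(\<integral>\<^sup>+s. ennreal (indicator {0..t} s * (C * s powr (- \<alpha>))) \<partial>lborel) = ennreal (C * (t powr (- \<alpha> + 1) / (- \<alpha> + 1)))"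
    using assms by (intro nn_integral_has_integral_lebesgue) auto
  have "(\<integral>\<^sup>+s. indicator {0<..<t} s * ennreal (C * s powr (- \<alpha>)) \<partial>lborel)
     \<le> (\<integral>\<^sup>+s. ennreal (indicator {0..t} s * (C * s powr (- \<alpha>))) \<partial>lborel)"
    using assms by (intro nn_integral_mono) (auto simp: indicator_def)
  then show ?thesis unfolding * by simp
qed

lemma nn_integral_powr_to_infinity:
  fixes \<alpha> C :: real
  assumes "1 < \<alpha>" "0 \<le> C"
  shows "(\<integral>\<^sup>+s. indicator {1..} s * ennreal (C * s powr (- \<alpha>)) \<partial>lborel) = ennreal (C / (\<alpha> - 1))"
proof -
  have "((\<lambda>s. C * s powr (- \<alpha>)) has_integral C * (- (1 powr (- \<alpha> + 1)) / (- \<alpha> + 1))) {1..}"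
    using assms by (intro has_integral_mult_right has_integral_powr_to_inf) auto
  then have *: "(\<integral>\<^sup>+s. ennreal (indicator {1..} s * (C * s powr (- \<alpha>))) \<partial>lborel) = ennreal (C * (- (1 powr (- \<alpha> + 1)) / (- \<alpha> + 1)))"
    using assms by (intro nn_integral_has_integral_lebesgue) auto
  have "(\<integral>\<^sup>+s. indicator {1..} s * ennreal (C * s powr (- \<alpha>)) \<partial>lborel)
     = (\<integral>\<^sup>+s. ennreal (indicator {1..} s * (C * s powr (- \<alpha>))) \<partial>lborel)"
    by (intro nn_integral_cong) (auto simp: indicator_def)
  moreover have "C * (- (1 powr (- \<alpha> + 1)) / (- \<alpha> + 1)) = C / (\<alpha> - 1)"
    using assms by (simp add: field_simps)
  ultimately show ?thesis using * by simp
qed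

text \<open>The heat semigroup at time \<tau>, applied to |V|, has supremum at most C
  \<tau>^(-\<alpha>). For L^p in dimension d the exponent is d / (2 p). The value 1 is critical:
  \<alpha> < 1 gives integrability in time at 0, and \<alpha> > 1 at infinity.\<close>

definition gauss_average_bound :: "real \<Rightarrow> real \<Rightarrow> ('c::euclidean_space \<Rightarrow> real) \<Rightarrow> bool" where
  "gauss_average_bound C \<alpha> V \<longleftrightarrow> 0 \<le> C \<and> (\<forall>\<tau>>0. \<forall>m.
     (\<integral>\<^sup>+z. ennreal (gauss_kernel \<tau> m z * \<bar>V z\<bar>) \<partial>lborel) \<le> ennreal (C * \<tau> powr (- \<alpha>)))"

lemma kato_integral_le_powr:
  fixes V :: "'c::euclidean_space \<Rightarrow> real"
  assumes [measurable]: "V \<in> borel_measurable borel"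
    and V: "gauss_average_bound C \<alpha> V" and \<alpha>: "0 \<le> \<alpha>" "\<alpha> < 1" and "0 < t"
  shows "kato_integral V t x y \<le> ennreal (2 * (C * 2 powr \<alpha> * t powr (1 - \<alpha>) / (1 - \<alpha>)) * gauss_kernel t x y)"
proof -
  have C: "0 \<le> C" using V by (simp add: gauss_average_bound_def)
  define I where "I = C * 2 powr \<alpha> * t powr (1 - \<alpha>) / (1 - \<alpha>)"
  have I: "0 \<le> I" using \<alpha> C by (simp add: I_def)
  have "kato_integral V t x y \<le> ennreal (gauss_kernel t x y) *
      (\<integral>\<^sup>+s. indicator {0<..<t} s * ennreal (C * (s * (t - s) / t) powr (- \<alpha>)) \<partial>lborel)"
    using V by (intro kato_integral_le_bridge) (auto simp: gauss_average_bound_def)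
  also have "\<dots> \<le> ennreal (gauss_kernel t x y) * (2 * (\<integral>\<^sup>+s. indicator {0<..<t} s * ennreal (C * (s / 2) powr (- \<alpha>)) \<partial>lborel))"
    using \<alpha> C by (intro mult_left_mono nn_integral_bridge_time_le) (auto intro!: mult_left_mono powr_mono2')
  also have "(\<integral>\<^sup>+s. indicator {0<..<t} s * ennreal (C * (s / 2) powr (- \<alpha>)) \<partial>lborel)
      = (\<integral>\<^sup>+s. indicator {0<..<t} s * ennreal ((C * 2 powr \<alpha>) * s powr (- \<alpha>)) \<partial>lborel)"
    by (intro nn_integral_cong) (auto simp: indicator_def powr_divide powr_minus field_simps)
  also have "\<dots> \<le> ennreal I"
    unfolding I_def using \<alpha> C \<open>0 < t\<close> by (intro nn_integral_powr_from_0) auto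
  also have "ennreal (gauss_kernel t x y) * (2 * ennreal I) = ennreal (2 * I * gauss_kernel t x y)"
    using I by (simp add: ennreal_mult mult_ac)
  finally show ?thesis by (simp add: I_def mult_left_mono)
qed

lemma kato_potentialI:
  fixes V :: "'c::euclidean_space \<Rightarrow> real"
  assumes meas: "V \<in> borel_measurable borel"
    and V: "gauss_average_bound C \<alpha> V" and \<alpha>: "0 \<le> \<alpha>" "\<alpha> < 1"
  shows "kato_potential V"
proof -
  have C: "0 \<le> C" using V by (simp add: gauss_average_bound_def)
  define K where "K = 2 * (C * 2 powr \<alpha> / (1 - \<alpha>))"
  have K: "0 \<le> K" using C \<alpha> by (simp add: K_def)
  have bd: "kato_integral V t x y \<le> ennreal (K * T powr (1 - \<alpha>) * gauss_kernel t x y)" if "0 < t" "t \<le> T" for t T x y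
  proof -
    have "kato_integral V t x y \<le> ennreal (K * t powr (1 - \<alpha>) * gauss_kernel t x y)"
      using kato_integral_le_powr[OF meas V \<alpha> that(1), of x y] by (simp add: K_def mult_ac)
    also have "\<dots> \<le> ennreal (K * T powr (1 - \<alpha>) * gauss_kernel t x y)"
      using that K \<alpha> by (intro ennreal_leI mult_right_mono mult_left_mono powr_mono2) auto
    finally show ?thesis .
  qed
  show ?thesis
  proof
    show "V \<in> borel_measurable borel" by fact
    show "\<exists>M\<ge>0. \<forall>t x y. 0 < t \<and> t \<le> T \<longrightarrow> kato_integral V t x y \<le> ennreal (M * gauss_kernel t x y)" for T
      using bd K by (intro exI[of _ "K * T powr (1 - \<alpha>)"]) auto
    \<comment> \<open>S solves (K + 1) S^(1 - \<alpha>) = 1 / 4; taking K + 1 keeps the denominator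
      positive when K = 0.\<close>
    define S where "S = (1 / (4 * (K + 1))) powr (1 / (1 - \<alpha>))"
    have "S powr (1 - \<alpha>) = 1 / (4 * (K + 1))" using K \<alpha> by (simp add: S_def powr_powr)
    then have "(K + 1) * S powr (1 - \<alpha>) = 1 / 4" using K by simp
    moreover have "K * S powr (1 - \<alpha>) \<le> (K + 1) * S powr (1 - \<alpha>)" by (intro mult_right_mono) auto
    ultimately have S: "K * S powr (1 - \<alpha>) \<le> 1 / 4" by simp
    have "kato_integral V t x y \<le> ennreal (1 / 4 * gauss_kernel t x y)" if "0 < t" "t \<le> S" for t x y
      using bd[OF that, of x y] S by (meson ennreal_leI gauss_kernel_nonneg mult_right_mono order_trans)
    moreover have "0 < S" using K by (simp add: S_def)
    ultimately show "\<exists>T>0. \<forall>t x y. 0 < t \<and> t \<le> T \<longrightarrow> kato_integral V t x y \<le> ennreal (1 / 4 * gauss_kernel t x y)"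
      by blast
  qed
qed

lemma kato_integral_le_uniform:
  fixes V :: "'c::euclidean_space \<Rightarrow> real"
  assumes [measurable]: "V \<in> borel_measurable borel"
    and V: "gauss_average_bound C \<alpha> V" "gauss_average_bound D \<beta> V" and \<alpha>: "0 \<le> \<alpha>" "\<alpha> < 1" and \<beta>: "1 < \<beta>"
  shows "\<exists>M\<ge>0. \<forall>t>0. \<forall>x y. kato_integral V t x y \<le> ennreal (M * gauss_kernel t x y)"
proof -
  have C: "0 \<le> C" "0 \<le> D" using V by (simp_all add: gauss_average_bound_def)
  define I where "I = C * 2 powr \<alpha> * 1 powr (1 - \<alpha>) / (1 - \<alpha>)"
  define J where "J = D * 2 powr \<beta> / (\<beta> - 1)"
  have IJ: "0 \<le> I" "0 \<le> J" using \<alpha> \<beta> C by (simp_all add: I_def J_def)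
  \<comment> \<open>The better of the two bounds at each time. The minimum is again nonincreasing,
    as \<open>nn_integral_bridge_time_le\<close> requires, and it is integrable both at 0 and at
    infinity.\<close>
  define k where "k = (\<lambda>\<tau>::real. min (C * \<tau> powr (- \<alpha>)) (D * \<tau> powr (- \<beta>)))"
  have [measurable]: "k \<in> borel_measurable borel" unfolding k_def by measurable
  have k_nonneg: "0 \<le> k \<tau>" for \<tau>
    using C by (simp add: k_def)
  have k_anti: "k \<tau> \<le> k \<sigma>" if "0 < \<sigma>" "\<sigma> \<le> \<tau>" for \<sigma> \<tau>
    unfolding k_def using that \<alpha> \<beta> C by (intro min.mono mult_left_mono powr_mono2') auto
  have "kato_integral V t x y \<le> ennreal (2 * (I + J) * gauss_kernel t x y)" for t x y
  proof -
    have "kato_integral V t x y \<le> ennreal (gauss_kernel t x y) *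
        (\<integral>\<^sup>+s. indicator {0<..<t} s * ennreal (k (s * (t - s) / t)) \<partial>lborel)"
      using V by (intro kato_integral_le_bridge) (auto simp: gauss_average_bound_def k_def min_def)
    also have "\<dots> \<le> ennreal (gauss_kernel t x y) * (2 * (\<integral>\<^sup>+s. indicator {0<..<t} s * ennreal (k (s / 2)) \<partial>lborel))"
      using k_nonneg k_anti by (intro mult_left_mono nn_integral_bridge_time_le) auto
    \<comment> \<open>The integral over (0, t) is enlarged to the half-line and cut at s = 1, so the
      bound no longer depends on t.\<close>
    also have "(\<integral>\<^sup>+s. indicator {0<..<t} s * ennreal (k (s / 2)) \<partial>lborel)
        \<le> (\<integral>\<^sup>+s. indicator {0<..<1} s * ennreal ((C * 2 powr \<alpha>) * s powr (- \<alpha>)) +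
             indicator {1..} s * ennreal ((D * 2 powr \<beta>) * s powr (- \<beta>)) \<partial>lborel)"
    proof (intro nn_integral_mono)
      fix s :: real
      have "(s / 2) powr (- \<gamma>) = 2 powr \<gamma> * s powr (- \<gamma>)" if "0 < s" for \<gamma>
        using that by (simp add: powr_divide powr_minus field_simps)
      then have "0 < s \<Longrightarrow> k (s / 2) \<le> (C * 2 powr \<alpha>) * s powr (- \<alpha>)"
        "0 < s \<Longrightarrow> k (s / 2) \<le> (D * 2 powr \<beta>) * s powr (- \<beta>)"
        by (simp_all add: k_def min_le_iff_disj mult.assoc)
      then show "indicator {0<..<t} s * ennreal (k (s / 2)) \<le> indicator {0<..<1} s * ennreal ((C * 2 powr \<alpha>) * s powr (- \<alpha>)) +
             indicator {1..} s * ennreal ((D * 2 powr \<beta>) * s powr (- \<beta>))"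
        by (cases "s < 1") (auto simp: indicator_def intro!: ennreal_leI)
    qed
    also have "\<dots> = (\<integral>\<^sup>+s. indicator {0<..<1} s * ennreal ((C * 2 powr \<alpha>) * s powr (- \<alpha>)) \<partial>lborel)
        + (\<integral>\<^sup>+s. indicator {1..} s * ennreal ((D * 2 powr \<beta>) * s powr (- \<beta>)) \<partial>lborel)"
      by (rule nn_integral_add) measurable
    also have "\<dots> \<le> ennreal I + ennreal J"
      unfolding I_def J_def using \<alpha> \<beta> C
      by (intro add_mono nn_integral_powr_from_0 nn_integral_powr_to_infinity[THEN eq_refl]) auto
    also have "ennreal (gauss_kernel t x y) * (2 * (ennreal I + ennreal J)) = ennreal (2 * (I + J) * gauss_kernel t x y)"
    proof -
      have "2 * (ennreal I + ennreal J) = ennreal (2 * (I + J))"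
        using IJ by (simp add: ennreal_mult del: distrib_left_numeral)
      then show ?thesis
        using IJ by (simp only: mult.commute[of "2 * (I + J)"] ennreal_mult' gauss_kernel_nonneg)
    qed
    finally show ?thesis by (simp add: mult_left_mono)
  qed
  then show ?thesis using IJ by (intro exI[of _ "2 * (I + J)"]) auto
qed

section \<open>Products of potentials in Lebesgue spaces\<close>

text \<open>
  For \<open>p = \<infinity>\<close> the exponent is \<open>0\<close>, because \<open>enn2real \<infinity> = 0\<close> and \<open>x / 0 = 0\<close>.  For \<open>p < \<infinity>\<close>,
  Hoelder's inequality is replaced by the pointwise bound \<open>v \<le> \<kappa> + \<kappa> powr (1 - p) * v powr p\<close>, with
  \<open>\<kappa>\<close> chosen so that \<open>\<kappa> powr p\<close> is the maximum of the kernel.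
\<close>

lemma Lp_space_gauss_average_le:
  fixes f :: "'c::euclidean_space \<Rightarrow> real"
  assumes p: "1 \<le> p" and f: "f \<in> Lp_space p lborel"
  shows "\<exists>C\<ge>0. \<forall>\<tau>>0. \<forall>m. (\<integral>\<^sup>+z. ennreal (gauss_kernel \<tau> m z * \<bar>f z\<bar>) \<partial>lborel)
            \<le> ennreal (C * \<tau> powr (- (real DIM('c) / (2 * enn2real p))))"
proof (cases "p = \<infinity>")
  case True
  then obtain C where C: "AE x in lborel. \<bar>f x\<bar> \<le> C" using f by (auto simp: Lp_space_def)
  show ?thesis
  proof (intro exI[of _ "max C 0"] conjI allI impI)
    fix \<tau> :: real and m :: 'c assume t: "0 < \<tau>"
    have "(\<integral>\<^sup>+z. ennreal (gauss_kernel \<tau> m z * \<bar>f z\<bar>) \<partial>lborel) \<le> (\<integral>\<^sup>+z. ennreal (max C 0) * ennreal (gauss_kernel \<tau> m z) \<partial>lborel)"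
    proof (intro nn_integral_mono_AE, use C in eventually_elim)
      case (elim z)
      then have "gauss_kernel \<tau> m z * \<bar>f z\<bar> \<le> gauss_kernel \<tau> m z * max C 0"
        by (intro mult_left_mono) auto
      then show ?case by (simp add: ennreal_mult [symmetric] ennreal_leI mult.commute)
    qed
    also have "\<dots> = ennreal (max C 0)"
      using t by (subst nn_integral_cmult) (auto simp: nn_integral_gauss_kernel)
    finally show "(\<integral>\<^sup>+z. ennreal (gauss_kernel \<tau> m z * \<bar>f z\<bar>) \<partial>lborel)
            \<le> ennreal (max C 0 * \<tau> powr (- (real DIM('c) / (2 * enn2real p))))"
      using t True by simp
  qed simp
next
  case False
  define P where "P = enn2real p"
  have P: "1 \<le> P" using p False unfolding P_def
    by (metis enn2real_1 enn2real_mono top.not_eq_extremum infinity_ennreal_def)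
  have meas [measurable]: "f \<in> borel_measurable borel" using f by (simp add: Lp_space_def)
  have fin: "(\<integral>\<^sup>+ x. ennreal (\<bar>f x\<bar> powr P) \<partial>lborel) < \<infinity>" using f False by (simp add: Lp_space_def P_def)
  define I where "I = enn2real (\<integral>\<^sup>+ x. ennreal (\<bar>f x\<bar> powr P) \<partial>lborel)"
  have I: "(\<integral>\<^sup>+ x. ennreal (\<bar>f x\<bar> powr P) \<partial>lborel) = ennreal I" "0 \<le> I"
    using fin by (auto simp: I_def less_top)
  define \<beta> where "\<beta> = real DIM('c) / (2 * P)"
  show ?thesis
  \<comment> \<open>The summand 1 stems from the mass of the kernel, and I from the integral of
    |f|^p.\<close>
  proof (intro exI[of _ "(1 + I) * (4 * pi) powr (- \<beta>)"] conjI allI impI)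
    fix \<tau> :: real and m :: 'c assume t: "0 < \<tau>"
    define \<kappa> where "\<kappa> = (4 * pi * \<tau>) powr (- \<beta>)"
    have l: "0 < \<kappa>" using t by (simp add: \<kappa>_def)
    have lP: "\<kappa> powr P = (4 * pi * \<tau>) powr (- (real DIM('c) / 2))"
      using P by (simp add: \<kappa>_def powr_powr \<beta>_def)
    have young: "v \<le> \<kappa> + \<kappa> powr (1 - P) * v powr P" if "0 \<le> v" for v
    proof (cases "v \<le> \<kappa>")
      case True
      then show ?thesis by (rule order_trans) simp
    next
      case False
      have "v = v powr (1 - P) * v powr P" using l False by (simp add: powr_add [symmetric])
      also have "\<dots> \<le> \<kappa> powr (1 - P) * v powr P"
        using False l P by (intro mult_right_mono powr_mono2') auto
      finally show ?thesis using l by simp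
    qed
    have "gauss_kernel \<tau> m z * \<bar>f z\<bar> \<le> \<kappa> * gauss_kernel \<tau> m z + \<kappa> * \<bar>f z\<bar> powr P" for z
    proof -
      have "gauss_kernel \<tau> m z * \<bar>f z\<bar> \<le> gauss_kernel \<tau> m z * (\<kappa> + \<kappa> powr (1 - P) * \<bar>f z\<bar> powr P)"
        by (intro mult_left_mono young) auto
      also have "\<dots> \<le> \<kappa> * gauss_kernel \<tau> m z + \<kappa> powr P * (\<kappa> powr (1 - P) * \<bar>f z\<bar> powr P)"
        using mult_right_mono[OF gauss_kernel_le[OF t, of m z], of "\<kappa> powr (1 - P) * \<bar>f z\<bar> powr P"]
        by (simp add: lP algebra_simps)
      also have "\<kappa> powr P * (\<kappa> powr (1 - P) * \<bar>f z\<bar> powr P) = \<kappa> * \<bar>f z\<bar> powr P"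
        using l by (simp add: powr_add [symmetric] mult.assoc [symmetric])
      finally show ?thesis .
    qed
    then have "(\<integral>\<^sup>+z. ennreal (gauss_kernel \<tau> m z * \<bar>f z\<bar>) \<partial>lborel)
      \<le> (\<integral>\<^sup>+z. ennreal \<kappa> * ennreal (gauss_kernel \<tau> m z) + ennreal \<kappa> * ennreal (\<bar>f z\<bar> powr P) \<partial>lborel)"
      using l by (intro nn_integral_mono) (simp add: ennreal_mult [symmetric] ennreal_plus [symmetric] ennreal_leI del: ennreal_plus)
    also have "\<dots> = ennreal \<kappa> + ennreal \<kappa> * ennreal I"
      using t by (simp add: nn_integral_add nn_integral_cmult nn_integral_gauss_kernel I)
    also have "\<dots> = ennreal ((1 + I) * \<kappa>)"
      using l I by (simp add: ennreal_mult [symmetric] ennreal_plus [symmetric] algebra_simps del: ennreal_plus)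
    also have "(1 + I) * \<kappa> = (1 + I) * (4 * pi) powr (- \<beta>) * \<tau> powr (- \<beta>)"
      using t by (simp add: \<kappa>_def powr_mult)
    finally show "(\<integral>\<^sup>+z. ennreal (gauss_kernel \<tau> m z * \<bar>f z\<bar>) \<partial>lborel)
            \<le> ennreal ((1 + I) * (4 * pi) powr (- \<beta>) * \<tau> powr (- (real DIM('c) / (2 * enn2real p))))"
      by (simp add: \<beta>_def P_def)
  qed (use I in simp)
qed

lemma gauss_average_bound_Lp:
  fixes f :: "'c::euclidean_space \<Rightarrow> real"
  assumes "1 \<le> p" "f \<in> Lp_space p lborel"
  shows "\<exists>C. gauss_average_bound C (real DIM('c) / (2 * enn2real p)) f"
  using Lp_space_gauss_average_le[OF assms] unfolding gauss_average_bound_def by blast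

text \<open>The kernel on the product space factorises, so by Tonelli the average of |V| is the
  product of those of the two factors, and the exponents add. This is where the product form of V
  enters.\<close>

lemma gauss_average_bound_times:
  fixes V1 :: "'a::euclidean_space \<Rightarrow> real" and V2 :: "'b::euclidean_space \<Rightarrow> real"
  assumes [measurable]: "V1 \<in> borel_measurable borel" "V2 \<in> borel_measurable borel"
    and V: "\<And>x1 x2. V (x1, x2) = V1 x1 * V2 x2"
    and V1: "gauss_average_bound C \<alpha> V1" and V2: "gauss_average_bound D \<beta> V2"
  shows "gauss_average_bound (C * D) (\<alpha> + \<beta>) V"
  unfolding gauss_average_bound_def
proof (intro conjI allI impI)
  have CD: "0 \<le> C" "0 \<le> D" using V1 V2 by (simp_all add: gauss_average_bound_def)
  then show "0 \<le> C * D" by simp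
  fix \<tau> :: real and m :: "'a \<times> 'b" assume t: "0 < \<tau>"
  let ?A = "\<lambda>z1. ennreal (gauss_kernel \<tau> (fst m) z1 * \<bar>V1 z1\<bar>)"
  let ?B = "\<lambda>z2. ennreal (gauss_kernel \<tau> (snd m) z2 * \<bar>V2 z2\<bar>)"
  have e: "ennreal (gauss_kernel \<tau> m z * \<bar>V z\<bar>) = ?A (fst z) * ?B (snd z)" for z
    by (cases m, cases z) (simp add: gauss_kernel_Pair V abs_mult mult_ac flip: ennreal_mult)
  have "(\<integral>\<^sup>+z. ennreal (gauss_kernel \<tau> m z * \<bar>V z\<bar>) \<partial>lborel) = (\<integral>\<^sup>+z1. \<integral>\<^sup>+z2. ?A z1 * ?B z2 \<partial>lborel \<partial>lborel)"
    unfolding e lborel_prod [symmetric] by (subst lborel.nn_integral_fst [symmetric]) auto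
  also have "\<dots> = (\<integral>\<^sup>+z1. ?A z1 \<partial>lborel) * (\<integral>\<^sup>+z2. ?B z2 \<partial>lborel)"
    by (simp add: nn_integral_cmult nn_integral_multc)
  also have "\<dots> \<le> ennreal (C * \<tau> powr (- \<alpha>)) * ennreal (D * \<tau> powr (- \<beta>))"
    using V1 V2 t by (intro mult_mono) (auto simp: gauss_average_bound_def)
  also have "\<dots> = ennreal (C * D * \<tau> powr (- (\<alpha> + \<beta>)))"
    using CD powr_add[of \<tau> "- \<alpha>" "- \<beta>"] by (simp add: ennreal_mult [symmetric] mult_ac)
  finally show "(\<integral>\<^sup>+z. ennreal (gauss_kernel \<tau> m z * \<bar>V z\<bar>) \<partial>lborel) \<le> ennreal (C * D * \<tau> powr (- (\<alpha> + \<beta>)))" .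
qed

text \<open>Passes from the extended exponents of the theorem to real ones. At p = \<infinity> both
  sides vanish, the right one through the defaults \<open>enn2real \<infinity> = 0\<close> and
  \<open>x / 0 = 0\<close>, in agreement with 1 / \<infinity> = 0.\<close>

lemma ennreal_dim_exponent:
  fixes p :: ennreal
  assumes "1 \<le> p"
  shows "of_nat d / (2 * p) = ennreal (real d / (2 * enn2real p))"
proof (cases p)
  case (real P)
  then have "1 \<le> P" using assms by (simp flip: ennreal_1)
  have "2 * p = ennreal (2 * P)" using real by (simp add: ennreal_mult)
  then show ?thesis using real \<open>1 \<le> P\<close>
    by (simp add: divide_ennreal ennreal_of_nat_eq_real_of_nat)
next
  case top
  then show ?thesis by (simp add: ennreal_mult_top)
qed

text \<open>For r = \<infinity> the left side is 0 by the same defaults, and strictness comes from d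
  > 0.\<close>

lemma dim_exponent_strict_antimono:
  fixes p r :: ennreal
  assumes "1 \<le> p" "p < r" "0 < d"
  shows "real d / (2 * enn2real r) < real d / (2 * enn2real p)"
proof -
  have p: "p < top" using assms(2) by (metis less_top order_less_imp_le top.extremum_strict neq_iff)
  then obtain P where P: "p = ennreal P" "1 \<le> P" using assms(1)
    by (cases p) (auto simp flip: ennreal_1)
  show ?thesis
  proof (cases r)
    case (real R)
    then have "P < R" using P assms by (simp add: ennreal_less_iff)
    then show ?thesis using real P assms by (simp add: divide_strict_left_mono)
  next
    case top
    then show ?thesis using P assms by simp
  qed
qed

theorem corollary2p10:
  fixes V :: "'a::euclidean_space \<times> 'b::euclidean_space \<Rightarrow> real"
    and p\<^sub>1 p\<^sub>2 :: ennreal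
  assumes "V \<in> borel_measurable borel"
    and "1 \<le> p\<^sub>1" and "1 \<le> p\<^sub>2"
    and "of_nat DIM('a) / (2 * p\<^sub>1) + of_nat DIM('b) / (2 * p\<^sub>2) = 1"
  shows "(\<forall>(r::ennreal) (V\<^sub>1 :: 'a \<Rightarrow> real) (V\<^sub>2 :: 'b \<Rightarrow> real).
            p\<^sub>1 < r \<and> (\<forall>x\<^sub>1 x\<^sub>2. V (x\<^sub>1, x\<^sub>2) = V\<^sub>1 x\<^sub>1 * V\<^sub>2 x\<^sub>2) \<and>
            V\<^sub>1 \<in> Lp_space r lborel \<and> V\<^sub>2 \<in> Lp_space p\<^sub>2 lborel \<longrightarrow>
            (\<forall>T::real. T > 0 \<longrightarrow>
              (\<exists>c\<^sub>1 c\<^sub>2 :: real. 0 < c\<^sub>1 \<and> c\<^sub>1 \<le> c\<^sub>2 \<and>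
                (\<forall>t x y. 0 < t \<and> t \<le> T \<longrightarrow>
                  c\<^sub>1 \<le> schroedinger_kernel V t x y / gauss_kernel t x y \<and>
                  schroedinger_kernel V t x y / gauss_kernel t x y \<le> c\<^sub>2))))
       \<and> (\<forall>(q::ennreal) (r::ennreal) (V\<^sub>1 :: 'a \<Rightarrow> real) (V\<^sub>2 :: 'b \<Rightarrow> real).
            (\<forall>x. V x \<le> 0) \<and> 1 \<le> q \<and> q < p\<^sub>1 \<and> p\<^sub>1 < r \<and>
            (\<forall>x\<^sub>1 x\<^sub>2. V (x\<^sub>1, x\<^sub>2) = V\<^sub>1 x\<^sub>1 * V\<^sub>2 x\<^sub>2) \<and>
            V\<^sub>1 \<in> Lp_space q lborel \<inter> Lp_space r lborel \<and> V\<^sub>2 \<in> Lp_space p\<^sub>2 lborel \<longrightarrow>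
            (\<exists>c\<^sub>1 c\<^sub>2 :: real. 0 < c\<^sub>1 \<and> c\<^sub>1 \<le> c\<^sub>2 \<and>
              (\<forall>t x y. 0 < t \<longrightarrow>
                c\<^sub>1 \<le> schroedinger_kernel V t x y / gauss_kernel t x y \<and>
                schroedinger_kernel V t x y / gauss_kernel t x y \<le> c\<^sub>2)))"
proof -
  \<comment> \<open>The decay exponent of V when its first factor is in L^r. The hypothesis on the
    two exponents makes it critical, that is 1, at r = \<open>p\<^sub>1\<close>; a larger r brings
    it below 1, and q < \<open>p\<^sub>1\<close> above 1.\<close>
  define \<alpha> where "\<alpha> = (\<lambda>r. real DIM('a) / (2 * enn2real r) + real DIM('b) / (2 * enn2real p\<^sub>2))"
  have "ennreal (\<alpha> p\<^sub>1) = 1"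
    using assms(4) by (simp add: \<alpha>_def ennreal_dim_exponent[OF assms(2)] ennreal_dim_exponent[OF assms(3)])
  then have \<alpha>_1: "\<alpha> p\<^sub>1 = 1" by simp
  have \<alpha>_nonneg: "0 \<le> \<alpha> r" for r by (simp add: \<alpha>_def)
  have \<alpha>_anti: "\<alpha> r < \<alpha> q" if "1 \<le> q" "q < r" for q r
    using dim_exponent_strict_antimono[OF that DIM_positive[where 'a = 'a]] by (simp add: \<alpha>_def)
  have average: "\<exists>C. gauss_average_bound C (\<alpha> r) V"
    if r: "1 \<le> r" and V: "\<forall>x\<^sub>1 x\<^sub>2. V (x\<^sub>1, x\<^sub>2) = V\<^sub>1 x\<^sub>1 * V\<^sub>2 x\<^sub>2"
      and V\<^sub>1: "V\<^sub>1 \<in> Lp_space r lborel" and V\<^sub>2: "V\<^sub>2 \<in> Lp_space p\<^sub>2 lborel"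
    for r and V\<^sub>1 :: "'a \<Rightarrow> real" and V\<^sub>2 :: "'b \<Rightarrow> real"
  proof -
    obtain C D where "gauss_average_bound C (real DIM('a) / (2 * enn2real r)) V\<^sub>1"
      "gauss_average_bound D (real DIM('b) / (2 * enn2real p\<^sub>2)) V\<^sub>2"
      using gauss_average_bound_Lp[OF r V\<^sub>1] gauss_average_bound_Lp[OF assms(3) V\<^sub>2] by blast
    moreover have "V\<^sub>1 \<in> borel_measurable borel" "V\<^sub>2 \<in> borel_measurable borel"
      using V\<^sub>1 V\<^sub>2 by (simp_all add: Lp_space_def)
    ultimately show ?thesis
      using gauss_average_bound_times[of V\<^sub>1 V\<^sub>2 V] V unfolding \<alpha>_def by blast
  qed
  have kato: "kato_potential V" and average_r: "\<exists>C. gauss_average_bound C (\<alpha> r) V"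
    if "p\<^sub>1 < r" "\<forall>x\<^sub>1 x\<^sub>2. V (x\<^sub>1, x\<^sub>2) = V\<^sub>1 x\<^sub>1 * V\<^sub>2 x\<^sub>2"
      "V\<^sub>1 \<in> Lp_space r lborel" "V\<^sub>2 \<in> Lp_space p\<^sub>2 lborel"
    for r and V\<^sub>1 :: "'a \<Rightarrow> real" and V\<^sub>2 :: "'b \<Rightarrow> real"
  proof -
    show *: "\<exists>C. gauss_average_bound C (\<alpha> r) V"
      using that assms(2) by (intro average) auto
    have "\<alpha> r < 1" using \<alpha>_anti[of p\<^sub>1 r] that assms(2) \<alpha>_1 by simp
    with * show "kato_potential V"
      using kato_potentialI[OF assms(1)] \<alpha>_nonneg by blast
  qed
  show ?thesis
  proof (intro conjI allI impI; elim conjE)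
    fix r V\<^sub>1 V\<^sub>2 and T :: real
    assume V: "p\<^sub>1 < r" "\<forall>x\<^sub>1 x\<^sub>2. V (x\<^sub>1, x\<^sub>2) = V\<^sub>1 x\<^sub>1 * V\<^sub>2 x\<^sub>2"
      "V\<^sub>1 \<in> Lp_space r lborel" "V\<^sub>2 \<in> Lp_space p\<^sub>2 lborel" and T: "0 < T"
    interpret kato_potential V using V by (rule kato)
    obtain M where M: "0 \<le> M" "\<And>t x y. 0 < t \<Longrightarrow> t \<le> T \<Longrightarrow> kato_integral V t x y \<le> ennreal (M * gauss_kernel t x y)"
      using kato_bounded[OF T] by blast
    obtain C where C: "\<And>t x y. 0 < t \<Longrightarrow> t \<le> T \<Longrightarrow> \<bar>schroedinger_kernel V t x y\<bar> \<le> C * gauss_kernel t x y"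
      using abs_schroedinger_kernel_bounded[OF T] by blast
    have lower: "exp (- 4 * M) \<le> schroedinger_kernel V t x y / gauss_kernel t x y" if "0 < t" "t \<le> T" for t x y
      using that M by (intro schroedinger_kernel_quotient_ge) auto
    have upper: "schroedinger_kernel V t x y / gauss_kernel t x y \<le> C" if "0 < t" "t \<le> T" for t x y
      using C[OF that, of x y] gauss_kernel_pos[OF that(1), of x y] by (simp add: pos_divide_le_eq)
    show "\<exists>c\<^sub>1 c\<^sub>2. 0 < c\<^sub>1 \<and> c\<^sub>1 \<le> c\<^sub>2 \<and> (\<forall>t x y. 0 < t \<and> t \<le> T \<longrightarrow>
        c\<^sub>1 \<le> schroedinger_kernel V t x y / gauss_kernel t x y \<and>
        schroedinger_kernel V t x y / gauss_kernel t x y \<le> c\<^sub>2)"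
      \<comment> \<open>The inequality between the two constants follows from both bounds at the
        time T.\<close>
      using lower upper order_trans[OF lower upper, OF T order_refl T order_refl]
      by (intro exI[of _ "exp (- 4 * M)"] exI[of _ C]) auto
  next
    fix q r V\<^sub>1 V\<^sub>2
    assume neg: "\<forall>x. V x \<le> 0" and q: "1 \<le> q" "q < p\<^sub>1"
      and V: "p\<^sub>1 < r" "\<forall>x\<^sub>1 x\<^sub>2. V (x\<^sub>1, x\<^sub>2) = V\<^sub>1 x\<^sub>1 * V\<^sub>2 x\<^sub>2"
        "V\<^sub>1 \<in> Lp_space q lborel \<inter> Lp_space r lborel" "V\<^sub>2 \<in> Lp_space p\<^sub>2 lborel"
    then have Vr: "V\<^sub>1 \<in> Lp_space r lborel" and Vq: "V\<^sub>1 \<in> Lp_space q lborel" by simp_all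
    interpret kato_potential V using V(1,2) Vr V(4) by (rule kato)
    obtain C where "gauss_average_bound C (\<alpha> r) V"
      using average_r[OF V(1,2) Vr V(4)] ..
    moreover obtain D where "gauss_average_bound D (\<alpha> q) V"
      using average[OF q(1) V(2) Vq V(4)] ..
    moreover have "\<alpha> r < 1" "1 < \<alpha> q"
      using \<alpha>_anti[OF assms(2) V(1)] \<alpha>_anti[OF q] \<alpha>_1 by simp_all
    ultimately obtain M where M: "0 \<le> M" "\<And>t x y. 0 < t \<Longrightarrow> kato_integral V t x y \<le> ennreal (M * gauss_kernel t x y)"
      using kato_integral_le_uniform[OF assms(1), of C "\<alpha> r" D "\<alpha> q"] \<alpha>_nonneg by blast
    have lower: "exp (- 4 * M) \<le> schroedinger_kernel V t x y / gauss_kernel t x y" if "0 < t" for t x y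
      using that M by (intro schroedinger_kernel_quotient_ge) auto
    have upper: "schroedinger_kernel V t x y / gauss_kernel t x y \<le> 1" if "0 < t" for t x y
      using schroedinger_kernel_le_gauss_kernel[of t x y] neg that gauss_kernel_pos[OF that, of x y]
      by (simp add: pos_divide_le_eq)
    show "\<exists>c\<^sub>1 c\<^sub>2. 0 < c\<^sub>1 \<and> c\<^sub>1 \<le> c\<^sub>2 \<and> (\<forall>t x y. 0 < t \<longrightarrow>
        c\<^sub>1 \<le> schroedinger_kernel V t x y / gauss_kernel t x y \<and>
        schroedinger_kernel V t x y / gauss_kernel t x y \<le> c\<^sub>2)"
      using lower upper M(1) by (intro exI[of _ "exp (- 4 * M)"] exI[of _ 1]) auto
  qed
qed

end
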